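(* Let $v_1,v_2\in\mathbb{R}^2$ be linearly independent unit vectors, $w\in\mathbb{R}^2$, and $$C(v_1,v_2,w)=\{z\in\mathbb{R}^2:z=w+a_1v_1+a_2v_2,\ a_1,a_2\ge0\}.$$ Let $\theta=\cos^{-1}(\langle v_1,v_2\rangle)\in(0,\pi)$. Let $v_1^\perp$ be the unit vector orthogonal to $v_1$ with $\langle v_1^\perp,v_2\rangle>0$, and $v_2^\perp$ the unit vector orthogonal to $v_2$ with $\langle v_2^\perp,v_1\rangle>0$. Then the coefficient $\mathcal{M}_j^{\gamma_{\mathbb{R}^2}}(C(v_1,v_2,w))$ of $r^j/j!$ in the power series expansion of $\gamma_{\mathbb{R}^2}(T(C(v_1,v_2,w),r))$ is given by: for $j=0$: $\gamma_{\mathbb{R}^2}(C(v_1,v_2,w))$; for $j=1$: $$\frac{1-\Phi(\langle v_1,w\rangle)}{\sqrt{2\pi}}e^{-\langle v_1^\perp,w\rangle^2/2}+\frac{1-\Phi(\langle v_2,w\rangle)}{\sqrt{2\pi}}e^{-\langle v_2^\perp,w\rangle^2/2};$$ for $j\ge2$: $$\frac{1-\Phi(\langle v_1,w\rangle)}{\sqrt{2\pi}}H_{j-1}(\langle v_1^\perp,w\rangle)e^{-\langle v_1^\perp,w\rangle^2/2}+\frac{1-\Phi(\langle v_2,w\rangle)}{\sqrt{2\pi}}H_{j-1}(\langle v_2^\perp,w\rangle)e^{-\langle v_2^\perp,w\rangle^2/2}$$ $$+\frac1{2\pi}\sum_{l=0}^{j-2}\binom{j-2}{l}K_{j,l}(\theta)\,H_{j-2-l}(\langle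 v_1,w\rangle)\,H_l(\langle v_1^\perp,w\rangle)\,e^{-\|w\|^2/2},$$ where $K_{j,l}(\theta)=(j-1)\int_0^{\pi-\theta}\sin^{j-2-l}\widetilde\theta\,\cos^l\widetilde\theta\,d\widetilde\theta$.
   Context: $\gamma_{\mathbb{R}^2}$ is the standard Gaussian measure on $\mathbb{R}^2$; $T(C,r)=\{x\in\mathbb{R}^2:d(x,C)\le r\}$ for $r\ge0$; $\Phi$ is the standard normal distribution function; $H_m(x)=(-1)^me^{x^2/2}\frac{d^m}{dx^m}e^{-x^2/2}$ are the Hermite polynomials. *)

theory Defs
  imports "HOL-Probability.Probability"
begin

definition gauss2 :: "(real^2) measure" where
  "gauss2 = density lborel (\<lambda>x. ennreal (exp (- (norm x)\<^sup>2 / 2) / (2 * pi)))"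

definition Phi :: "real \<Rightarrow> real" where
  "Phi = cdf std_normal_distribution"

definition hermite :: "nat \<Rightarrow> real \<Rightarrow> real" where
  "hermite m x = (-1) ^ m * exp (x\<^sup>2 / 2) * (deriv ^^ m) (\<lambda>y. exp (- y\<^sup>2 / 2)) x"

(* infdist x {} = 0 in the library, so this is the intended tube only for nonempty C. *)
definition tube :: "(real^2) set \<Rightarrow> real \<Rightarrow> (real^2) set" where
  "tube C r = {x. infdist x C \<le> r}"

definition cone2 :: "real^2 \<Rightarrow> real^2 \<Rightarrow> real^2 \<Rightarrow> (real^2) set" where
  "cone2 v1 v2 w = {z. \<exists>a1 a2. 0 \<le> a1 \<and> 0 \<le> a2 \<and> z = w + a1 *\<^sub>R v1 + a2 *\<^sub>R v2}"

definition has_tube_expansion :: "(real^2) set \<Rightarrow> (nat \<Rightarrow> real) \<Rightarrow> bool" where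
  "has_tube_expansion C a \<longleftrightarrow>
     (\<exists>\<epsilon>>0. \<forall>r. 0 \<le> r \<and> r < \<epsilon> \<longrightarrow> (\<lambda>j. a j * (r ^ j / fact j)) sums measure gauss2 (tube C r))"

(* There is at most one expansion, since a power series vanishing on a one-sided neighbourhood
   of 0 is zero; existence is not built in and has to be shown for each C. *)
definition gauss_minkowski :: "nat \<Rightarrow> (real^2) set \<Rightarrow> real" where
  "gauss_minkowski j C = (THE a. has_tube_expansion C a) j"

(* Used for j \<ge> 2 and l \<le> j - 2 only, where the natural-number subtractions are exact. *)
definition arc_coeff :: "nat \<Rightarrow> nat \<Rightarrow> real \<Rightarrow> real" where
  "arc_coeff j l \<theta> =
     real (j - 1) * integral {0..pi - \<theta>} (\<lambda>t. sin t ^ (j - 2 - l) * cos t ^ l)"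

end

theory Submission
  imports Defs
begin

text \<open>
  Split the plane according to the point of the cone \<open>C\<close> that is nearest to \<open>z\<close>: the nearest point
  is \<open>z\<close> itself, or it lies on one of the two edges, or it is the apex \<open>w\<close> (lemmas
  \<open>infdist_edge\<close> and \<open>infdist_vertex\<close>). Hence the tube of radius \<open>r\<close> is the disjoint union of \<open>C\<close>,
  of a half-infinite strip of width \<open>r\<close> along each edge, and of a circular sector of radius \<open>r\<close> and
  opening angle \<open>pi - \<theta>\<close> at the apex (\<open>tube_eq_Un\<close>), and it suffices to expand the Gaussian measure
  of each part in powers of \<open>r\<close>.

  All expansions come from one generating function,
  \<open>exp (x * s - s\<^sup>2 / 2) = (\<Sum>n. hermite n x * s ^ n / n!)\<close>, valid for all real \<open>s\<close>
  (\<open>hermite_sums\<close>): it says that the Gaussian density at \<open>x - s\<close> is the density at \<open>x\<close> times a power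
  series in \<open>s\<close> with Hermite coefficients.

  A strip is a rectangle in the orthonormal frame formed by the direction of the edge and its normal.
  There the Gaussian measure is a product of two standard normal distributions, so the strip has
  measure \<open>1 - Phi (v \<bullet> w)\<close> times the integral of the normal density from \<open>p \<bullet> w - r\<close> to
  \<open>p \<bullet> w\<close>; integrating the generating function termwise produces \<open>hermite (j - 1)\<close> in the
  coefficient of \<open>r ^ j / j!\<close> (\<open>edge_strip_sums\<close>).

  The sector is \<open>w - \<rho> (sin t v1 + cos t p1)\<close> with \<open>0 < \<rho> \<le> r\<close> and \<open>0 < t < pi - \<theta>\<close>. In these
  polar coordinates the density is a product of two generating functions, at the arguments
  \<open>\<rho> * sin t\<close> and \<open>\<rho> * cos t\<close>. Their Cauchy product has the binomial sum of Hermite products as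
  coefficients; integrating over \<open>t\<close> gives the trigonometric integrals, and integrating
  \<open>\<rho> * \<rho> ^ (j - 2)\<close> over the radius gives \<open>r ^ j / j\<close>, which accounts for the factor
  \<open>j - 1\<close> in \<open>arc_coeff\<close> because \<open>j! / j = (j - 1) * (j - 2)!\<close> (\<open>sector_sums\<close>).

  Finally, a power series is determined by its values on a one-sided neighbourhood of \<open>0\<close>
  (\<open>powser_one_sided_zero_imp_zero\<close>), so the coefficients found in this way are the
  Gaussian Minkowski coefficients.
\<close>

section \<open>Power series on the real line\<close>

text \<open>
  By the Weierstrass M-test the partial sums converge uniformly, and uniform limits commute with
  integrals over a compact interval.
\<close>

lemma sums_integral_Weierstrass:
  fixes f :: "nat \<Rightarrow> real \<Rightarrow> real"
  assumes cont: "\<And>n. continuous_on {a..b} (f n)"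
    and bound: "\<And>n x. x \<in> {a..b} \<Longrightarrow> \<bar>f n x\<bar> \<le> M n"
    and M: "summable M"
    and sums: "\<And>x. x \<in> {a..b} \<Longrightarrow> (\<lambda>n. f n x) sums F x"
  shows "(\<lambda>n. integral {a..b} (f n)) sums integral {a..b} F"
proof -
  have "uniform_limit {a..b} (\<lambda>n x. \<Sum>i<n. f i x) (\<lambda>x. \<Sum>i. f i x) sequentially"
    by (rule Weierstrass_m_test[OF _ M]) (use bound in auto)
  then have unif: "uniform_limit {a..b} (\<lambda>n x. \<Sum>i<n. f i x) F sequentially"
    by (rule uniform_limit_cong'[THEN iffD1, rotated -1])
      (auto simp: sums_unique[OF sums, symmetric])
  obtain I J where I: "\<And>n. ((\<lambda>x. \<Sum>i<n. f i x) has_integral I n) {a..b}"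
    and J: "(F has_integral J) {a..b}" and lim: "I \<longlonglongrightarrow> J"
    by (rule uniform_limit_integral[OF unif])
      (auto intro!: continuous_on_sum cont)
  have "I n = (\<Sum>i<n. integral {a..b} (f i))" for n
    using integral_unique[OF I[of n]] integral_sum[of "{..<n}" f "{a..b}"]
      integrable_continuous_real[OF cont] by simp
  then have "I = (\<lambda>n. \<Sum>i<n. integral {a..b} (f i))"
    by blast
  with lim J show ?thesis
    by (simp add: sums_def integral_unique)
qed

text \<open>
  The integrated series is indexed so that \<open>r ^ j\<close> has index \<open>j\<close>; its constant term is therefore a
  separate case.
\<close>

lemma powser_integral_sums:
  fixes c :: "nat \<Rightarrow> real"
  assumes f: "\<And>s. (\<lambda>n. c n * s ^ n) sums f s" and r: "0 \<le> r"
  shows "(\<lambda>j. (if j = 0 then 0 else c (j - 1) / j) * r ^ j) sums integral {0..r} f"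
proof -
  have "(\<lambda>n. integral {0..r} (\<lambda>s. c n * s ^ n)) sums integral {0..r} f"
  proof (rule sums_integral_Weierstrass)
    show "summable (\<lambda>n. norm (c n * r ^ n))"
      by (rule powser_insidea[OF sums_summable[OF f[of "\<bar>r\<bar> + 1"]]]) simp
    show "\<bar>c n * s ^ n\<bar> \<le> norm (c n * r ^ n)" if "s \<in> {0..r}" for n s
      using that by (auto simp: abs_mult intro!: mult_left_mono power_mono)
  qed (auto intro!: continuous_intros f)
  moreover have "integral {0..r} (\<lambda>s. c n * s ^ n) = (if Suc n = 0 then 0 else c (Suc n - 1) / Suc n) * r ^ Suc n" for n
  proof -
    have "((\<lambda>s. c n * s ^ n) has_integral c n / Suc n * r ^ Suc n - c n / Suc n * 0 ^ Suc n) {0..r}"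
    proof (rule fundamental_theorem_of_calculus[OF r])
      fix s :: real
      show "((\<lambda>s. c n / Suc n * s ^ Suc n) has_vector_derivative c n * s ^ n) (at s within {0..r})"
        using DERIV_cmult[OF DERIV_pow[of "Suc n" s "{0..r}"], of "c n / real (Suc n)"]
        by (simp add: has_real_derivative_iff_has_vector_derivative del: of_nat_Suc power_Suc)
    qed
    from integral_unique[OF this] show ?thesis
      by (simp del: integral_mult_right)
  qed
  ultimately have "(\<lambda>n. (if Suc n = 0 then 0 else c (Suc n - 1) / Suc n) * r ^ Suc n) sums integral {0..r} f"
    by simp
  then show ?thesis
    by (subst (asm) sums_Suc_iff) simp
qed

text \<open>
  Induction on \<open>k\<close> for all series at once: the derivative of an everywhere convergent series is again
  one, with coefficients \<open>diffs c\<close>, so the induction hypothesis applies to it.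
\<close>

lemma higher_deriv_powser_0:
  fixes c :: "nat \<Rightarrow> real"
  assumes "\<And>x. (\<lambda>n. c n * x ^ n) sums f x"
  shows "(deriv ^^ k) f 0 = fact k * c k"
  using assms
proof (induction k arbitrary: c f)
  case 0
  show ?case
    using 0[of 0] sums_unique2[OF powser_sums_zero] by (metis fact_0 funpow_0 mult_1)
next
  case (Suc k)
  have f: "f x = (\<Sum>n. c n * x ^ n)" for x
    using Suc.prems sums_unique by blast
  have summ: "summable (\<lambda>n. c n * x ^ n)" for x
    using Suc.prems sums_summable by blast
  have "f = (\<lambda>x. \<Sum>n. c n * x ^ n)"
    using f by blast
  then have "deriv f x = (\<Sum>n. diffs c n * x ^ n)" for x
    using termdiffs_strong_converges_everywhere[OF summ, of x] by (simp add: DERIV_imp_deriv)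
  then have "(\<lambda>n. diffs c n * x ^ n) sums deriv f x" for x
    using termdiff_converges_all[OF summ, of x] by (simp add: summable_sums)
  from Suc.IH[OF this] show ?case
    by (simp add: funpow_Suc_right diffs_def del: funpow.simps)
qed

lemma higher_deriv_translate:
  fixes f :: "real \<Rightarrow> real"
  shows "(deriv ^^ n) (\<lambda>s. f (x + s)) = (\<lambda>s. (deriv ^^ n) f (x + s))"
proof (induction n)
  case (Suc n)
  have "deriv (\<lambda>s. g (x + s)) s = deriv g (x + s)" for g :: "real \<Rightarrow> real" and s
    unfolding deriv_def using DERIV_shift[of g _ s x] by (simp add: add.commute)
  with Suc show ?case by simp
qed simp

text \<open>
  By strong induction the coefficients below \<open>m\<close> vanish, so \<open>d m\<close> is the value at \<open>0\<close> of the series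
  divided by \<open>r ^ m\<close>. That quotient is continuous at \<open>0\<close> and zero for small positive \<open>r\<close>, hence zero
  at \<open>0\<close> as well.
\<close>

lemma powser_one_sided_zero_imp_zero:
  fixes d :: "nat \<Rightarrow> real"
  assumes e: "e > 0" and z: "\<And>r. 0 \<le> r \<Longrightarrow> r < e \<Longrightarrow> (\<lambda>n. d n * r ^ n) sums 0"
  shows "d m = 0"
proof (induction m rule: less_induct)
  case (less m)
  define g where "g r = (\<Sum>n. d (n + m) * r ^ n)" for r
  have "summable (\<lambda>n. d n * (e/2) ^ n)"
    using z[of "e/2"] e by (auto intro: sums_summable)
  then have "summable (\<lambda>n. d (n + m) * (e/2) ^ (n + m))"
    by (rule summable_ignore_initial_segment)
  then have "summable (\<lambda>n. (d (n + m) * (e/2) ^ n) * (e/2)^m)"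
    by (simp add: power_add mult.assoc)
  then have s: "summable (\<lambda>n. d (n + m) * (e/2) ^ n)"
    using e by (auto dest: summable_mult_D[where c = "(e/2)^m"] simp: mult.commute)
  have g: "(\<lambda>n. d (n + m) * x ^ n) sums g x" if "norm x < e/2" for x
    unfolding g_def using that powser_inside[OF s, of x] e by (simp add: summable_sums)
  have lim: "g \<midarrow>0\<rightarrow> d m"
    by (rule powser_limit_0[where s = "e/2" and a = "\<lambda>n. d (n + m)", simplified]) (use g e in auto)
  have "g r = 0" if r: "0 < r" "r < e/2" for r
  proof -
    have "(\<lambda>n. d (n + m) * r ^ (n + m)) sums (0 - (\<Sum>i<m. d i * r ^ i))"
      using z[of r] r sums_split_initial_segment by fastforce
    moreover have "(\<Sum>i<m. d i * r ^ i) = 0"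
      using less by (intro sum.neutral) auto
    ultimately have "(\<lambda>n. (d (n + m) * r ^ n) * r ^ m) sums 0"
      by (simp add: power_add mult.assoc)
    moreover have "(\<lambda>n. (d (n + m) * r ^ n) * r ^ m) sums (g r * r ^ m)"
      by (intro sums_mult2 g) (use r in auto)
    ultimately have "g r * r ^ m = 0" by (rule sums_unique2[symmetric])
    then show ?thesis using r by simp
  qed
  then have "\<forall>\<^sub>F r in at_right 0. g r = 0"
    using e by (auto simp: eventually_at_right_field intro!: exI[of _ "e/2"])
  then have "(g \<longlongrightarrow> 0) (at_right 0)"
    by (rule tendsto_eventually)
  moreover have "(g \<longlongrightarrow> d m) (at_right 0)"
    using lim by (rule tendsto_within_subset) simp
  ultimately show ?case
    by (metis tendsto_unique trivial_limit_at_right_real)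
qed

text \<open>
  Two expansions of the same tube differ by a power series that vanishes to the right of \<open>0\<close>.
\<close>

lemma gauss_minkowski_eqI:
  assumes "has_tube_expansion C a"
  shows "gauss_minkowski j C = a j"
proof -
  have "b = a" if b: "has_tube_expansion C b" for b
  proof
    fix m
    obtain e1 where e1: "e1 > 0"
      "\<And>r. 0 \<le> r \<Longrightarrow> r < e1 \<Longrightarrow> (\<lambda>j. a j * (r ^ j / fact j)) sums measure gauss2 (tube C r)"
      using assms unfolding has_tube_expansion_def by blast
    obtain e2 where e2: "e2 > 0"
      "\<And>r. 0 \<le> r \<Longrightarrow> r < e2 \<Longrightarrow> (\<lambda>j. b j * (r ^ j / fact j)) sums measure gauss2 (tube C r)"
      using b unfolding has_tube_expansion_def by blast
    have "(\<lambda>j. (b j - a j) / fact j * r ^ j) sums 0" if "0 \<le> r" "r < min e1 e2" for r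
      using sums_diff[OF e2(2)[of r] e1(2)[of r]] that
      by (simp add: left_diff_distrib diff_divide_distrib)
    then have "(b m - a m) / fact m = 0"
      by (rule powser_one_sided_zero_imp_zero[where e = "min e1 e2", rotated]) (use e1(1) e2(1) in auto)
    then show "b m = a m" by simp
  qed
  then have "(THE a. has_tube_expansion C a) = a"
    using assms by blast
  then show ?thesis by (simp add: gauss_minkowski_def)
qed

section \<open>The generating function of the Hermite polynomials\<close>

text \<open>
  The Taylor coefficients of \<open>exp (- s\<^sup>2 / 2)\<close> at \<open>0\<close>, listed by the power of \<open>s\<close> so that the
  series can enter a Cauchy product.
\<close>

definition exp_sq_coeff :: "nat \<Rightarrow> real" where
  "exp_sq_coeff n = (if even n then (- 1 / 2) ^ (n div 2) / fact (n div 2) else 0)"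

text \<open>
  Only even powers occur, so both claims are statements about the exponential series at
  \<open>- s\<^sup>2 / 2\<close>, transported along \<open>n \<mapsto> 2 * n\<close>.
\<close>

lemma exp_sq_coeff_sums:
  fixes s :: real
  shows "(\<lambda>n. exp_sq_coeff n * s ^ n) sums exp (- s\<^sup>2 / 2)"
    and "summable (\<lambda>n. norm (exp_sq_coeff n * s ^ n))"
proof -
  have sm: "strict_mono (\<lambda>n::nat. 2 * n)"
    by (auto intro: strict_monoI)
  have nr: "exp_sq_coeff n = 0" if "n \<notin> range (\<lambda>n::nat. 2 * n)" for n
    using that by (auto simp: exp_sq_coeff_def elim: evenE)
  have ev: "exp_sq_coeff (2 * n) * s ^ (2 * n) = (- s\<^sup>2 / 2) ^ n /\<^sub>R fact n" for n
  proof -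
    have "- s\<^sup>2 / 2 = (- 1 / 2) * s\<^sup>2" by simp
    then have "(- s\<^sup>2 / 2) ^ n = (- 1 / 2) ^ n * s ^ (2 * n)"
      by (simp only: power_mult_distrib power_mult)
    then show ?thesis
      by (simp only: exp_sq_coeff_def divide_inverse) simp
  qed
  show "(\<lambda>n. exp_sq_coeff n * s ^ n) sums exp (- s\<^sup>2 / 2)"
  proof (subst sums_mono_reindex[OF sm, symmetric])
    show "(\<lambda>n. exp_sq_coeff (2 * n) * s ^ (2 * n)) sums exp (- s\<^sup>2 / 2)"
      unfolding ev by (rule exp_converges)
  qed (simp add: nr)
  have "summable (\<lambda>n. norm (exp_sq_coeff (2 * n) * s ^ (2 * n)))"
    unfolding ev by (rule summable_norm_exp)
  then show "summable (\<lambda>n. norm (exp_sq_coeff n * s ^ n))"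
    by (subst (asm) summable_mono_reindex[OF sm]) (simp_all add: nr)
qed

text \<open>
  The Cauchy product of the series of \<open>exp (x * s)\<close> and \<open>exp (- s\<^sup>2 / 2)\<close> converges for every \<open>s\<close>.
  Multiplied by \<open>exp (- x\<^sup>2 / 2)\<close> and read at \<open>- s\<close>, it is the expansion of
  \<open>exp (- (x + s)\<^sup>2 / 2)\<close>, whose coefficients are the derivatives that define the
  Hermite polynomials.
\<close>

lemma hermite_sums:
  "(\<lambda>n. hermite n x / fact n * s ^ n) sums exp (x * s - s\<^sup>2 / 2)"
proof -
  define a where "a n = (\<Sum>i\<le>n. x ^ i / fact i * exp_sq_coeff (n - i))" for n
  have a: "(\<lambda>n. a n * s ^ n) sums exp (x * s - s\<^sup>2 / 2)" for s
  proof -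
    have "(\<lambda>n. \<Sum>i\<le>n. ((x * s) ^ i /\<^sub>R fact i) * (exp_sq_coeff (n - i) * s ^ (n - i)))
        sums (exp (x * s) * exp (- s\<^sup>2 / 2))"
      using Cauchy_product_sums[OF summable_norm_exp[of "x * s"] exp_sq_coeff_sums(2)[of s]]
      by (simp only: sums_unique[OF exp_sq_coeff_sums(1), symmetric]
          sums_unique[OF exp_converges, symmetric])
    moreover have "(\<Sum>i\<le>n. ((x * s) ^ i /\<^sub>R fact i) * (exp_sq_coeff (n - i) * s ^ (n - i)))
        = (\<Sum>i\<le>n. (x ^ i / fact i * exp_sq_coeff (n - i)) * s ^ n)" for n
    proof (rule sum.cong[OF refl])
      fix i assume "i \<in> {..n}"
      then have "s ^ n = s ^ i * s ^ (n - i)" by (simp flip: power_add)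
      then show "((x * s) ^ i /\<^sub>R fact i) * (exp_sq_coeff (n - i) * s ^ (n - i))
        = (x ^ i / fact i * exp_sq_coeff (n - i)) * s ^ n"
        by (simp add: power_mult_distrib divide_inverse)
    qed
    moreover have "exp (x * s) * exp (- s\<^sup>2 / 2) = exp (x * s - s\<^sup>2 / 2)"
      by (simp flip: exp_add)
    ultimately show ?thesis
      by (simp only: a_def sum_distrib_right)
  qed
  have "(\<lambda>n. (exp (- x\<^sup>2 / 2) * ((-1) ^ n * a n)) * s ^ n) sums exp (- (x + s)\<^sup>2 / 2)" for s
  proof -
    have "(\<lambda>n. exp (- x\<^sup>2 / 2) * (a n * (- s) ^ n)) sums (exp (- x\<^sup>2 / 2) * exp (x * (- s) - (- s)\<^sup>2 / 2))"
      by (intro sums_mult a)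
    moreover have "exp (- x\<^sup>2 / 2) * exp (x * (- s) - (- s)\<^sup>2 / 2) = exp (- (x + s)\<^sup>2 / 2)"
      unfolding exp_add[symmetric] by (simp add: power2_eq_square field_simps)
    moreover have "exp (- x\<^sup>2 / 2) * (a n * (- s) ^ n)
        = (exp (- x\<^sup>2 / 2) * ((-1) ^ n * a n)) * s ^ n" for n
      by (subst power_minus) (simp only: mult_ac)
    ultimately show ?thesis by (simp only:)
  qed
  from higher_deriv_powser_0[OF this]
  have "(deriv ^^ n) (\<lambda>y. exp (- y\<^sup>2 / 2)) x = fact n * (exp (- x\<^sup>2 / 2) * ((-1) ^ n * a n))" for n
    unfolding higher_deriv_translate[of _ "\<lambda>y. exp (- y\<^sup>2 / 2)" x] by simp
  then have "hermite n x = ((-1) ^ n * (-1) ^ n) * (exp (x\<^sup>2 / 2) * exp (- x\<^sup>2 / 2)) * (fact n * a n)" for n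
    by (simp add: hermite_def)
  then have "hermite n x = fact n * a n" for n
    by (simp add: exp_minus flip: power_mult_distrib)
  with a show ?thesis by simp
qed

text \<open>
  Convergence at the larger argument \<open>\<bar>s\<bar> + 1\<close> forces absolute convergence at \<open>s\<close>.
\<close>

lemma hermite_summable_norm: "summable (\<lambda>n. norm (hermite n x / fact n * s ^ n))"
proof -
  have "summable (\<lambda>n. hermite n x / fact n * (\<bar>s\<bar> + 1) ^ n)"
    using hermite_sums sums_summable by blast
  then show ?thesis by (rule powser_insidea) auto
qed

section \<open>The planar Gaussian measure in orthonormal coordinates\<close>

definition frame :: "real^2 \<Rightarrow> real^2 \<Rightarrow> real \<times> real \<Rightarrow> real^2" where
  "frame u v = (\<lambda>(a, b). a *\<^sub>R u + b *\<^sub>R v)"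

lemma continuous_frame: "continuous_on S (frame u v)"
  unfolding frame_def case_prod_beta by (intro continuous_intros)

lemma measurable_frame [measurable]: "frame u v \<in> borel_measurable borel"
  by (intro borel_measurable_continuous_onI continuous_frame)

lemma frame_axis_nth:
  "frame (axis 1 1) (axis 2 1) q $ 1 = fst q" "frame (axis 1 1) (axis 2 1) q $ 2 = snd q"
  by (auto simp: frame_def axis_def split: prod.split)

text \<open>
  Both measures give a box the product of its side lengths. This identification makes Fubini's theorem,
  which concerns pairs, available for vectors of length two.
\<close>

lemma lborel_standard_frame:
  "distr lborel borel (frame (axis 1 1) (axis 2 1)) = lborel"
proof (rule sym, rule lborel_eqI)
  fix l u :: "real^2"
  assume "\<And>b. b \<in> Basis \<Longrightarrow> l \<bullet> b \<le> u \<bullet> b"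
  from this[of "axis 1 1"] this[of "axis 2 1"] have le: "l $ 1 \<le> u $ 1" "l $ 2 \<le> u $ 2"
    by (simp_all add: axis_in_Basis_iff inner_axis)
  have pre: "frame (axis 1 1) (axis 2 1) -` box l u = box (l $ 1, l $ 2) (u $ 1, u $ 2)"
    by (auto simp: mem_box_cart forall_2 frame_axis_nth mem_box Basis_prod_def)
  have "emeasure (distr lborel borel (frame (axis 1 1) (axis 2 1))) (box l u)
      = emeasure lborel (box (l $ 1, l $ 2) (u $ 1, u $ 2))"
    by (subst emeasure_distr) (auto simp: pre)
  also have "\<dots> = ennreal ((u $ 1 - l $ 1) * (u $ 2 - l $ 2))"
    using le by (simp add: emeasure_lborel_box_eq Basis_prod_def prod.union_disjoint)
  also have "(u $ 1 - l $ 1) * (u $ 2 - l $ 2) = (\<Prod>b\<in>Basis. (u - l) \<bullet> b)"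
    by (simp add: Basis_vec_def prod.union_disjoint axis_eq_axis inner_axis UNIV_2)
  finally show "emeasure (distr lborel borel (frame (axis 1 1) (axis 2 1))) (box l u)
      = (\<Prod>b\<in>Basis. (u - l) \<bullet> b)" .
qed simp

text \<open>
  Boxes generate the Borel sets, and the preimage of a box is its image under the inverse
  transformation, which is again orthogonal and so preserves Lebesgue measure.
\<close>

lemma lborel_orthogonal_transformation:
  fixes T :: "real^'n::{finite,wellorder} \<Rightarrow> real^'n::_"
  assumes T: "orthogonal_transformation T"
  shows "distr lborel borel T = lborel"
proof (rule sym, rule lborel_eqI)
  fix l u :: "real^'n::_"
  assume le: "\<And>b. b \<in> Basis \<Longrightarrow> l \<bullet> b \<le> u \<bullet> b"
  have [measurable]: "T \<in> borel_measurable borel"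
    using T by (intro borel_measurable_continuous_onI linear_continuous_on)
      (simp add: orthogonal_transformation_linear linear_linear)
  have pre: "T -` box l u = inv T ` box l u"
    using T by (simp add: bij_vimage_eq_inv_image orthogonal_transformation_bij)
  have "inv T ` box l u \<in> lmeasurable"
    using T by (intro measurable_orthogonal_image orthogonal_transformation_inv) auto
  moreover have "inv T ` box l u \<in> sets borel"
    unfolding pre[symmetric] using measurable_sets[OF \<open>T \<in> borel_measurable borel\<close>, of "box l u"] by simp
  ultimately have "emeasure lborel (inv T ` box l u) = ennreal (measure lebesgue (inv T ` box l u))"
    using emeasure_eq_measure2[of "inv T ` box l u" lebesgue]
      emeasure_completion[of "inv T ` box l u" lborel] main_part_sets[of "inv T ` box l u" lborel]
    by (simp add: fmeasurableD)
  also have "measure lebesgue (inv T ` box l u) = measure lebesgue (box l u)"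
    using T by (intro measure_orthogonal_image orthogonal_transformation_inv) auto
  also have "\<dots> = (\<Prod>b\<in>Basis. (u - l) \<bullet> b)"
    using le by (simp add: measure_completion measure_lborel_box_eq)
  finally show "emeasure (distr lborel borel T) (box l u) = (\<Prod>b\<in>Basis. (u - l) \<bullet> b)"
    by (subst emeasure_distr) (auto simp: pre)
qed simp

lemma lborel_orthonormal_frame:
  assumes "norm u = 1" "norm v = 1" "u \<bullet> v = 0"
  shows "distr lborel borel (frame u v) = lborel"
proof -
  define T where "T z = z $ 1 *\<^sub>R u + z $ 2 *\<^sub>R v" for z :: "real^2"
  have T: "orthogonal_transformation T"
    unfolding orthogonal_transformation
  proof (intro conjI allI)
    show "linear T"
      unfolding T_def by (intro linearI) (simp_all add: algebra_simps)
    show "norm (T z) = norm z" for z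
    proof -
      have "(norm (T z))\<^sup>2 = (norm z)\<^sup>2"
        using assms unfolding power2_norm_eq_inner T_def norm_eq_1
        by (simp add: inner_add_left inner_add_right inner_commute[of v u]
            inner_vec_def[of z z] sum_2 del: dot_square_norm)
      then show ?thesis by simp
    qed
  qed
  have [measurable]: "T \<in> borel_measurable borel"
    using T by (intro borel_measurable_continuous_onI linear_continuous_on)
      (simp add: orthogonal_transformation_linear linear_linear)
  have "frame u v = T \<circ> frame (axis 1 1) (axis 2 1)"
    by (auto simp: fun_eq_iff T_def frame_axis_nth) (simp add: frame_def)
  then have "distr lborel borel (frame u v) = distr (distr lborel borel (frame (axis 1 1) (axis 2 1))) borel T"
    by (subst distr_distr) auto
  then show ?thesis
    by (simp add: lborel_standard_frame lborel_orthogonal_transformation[OF T])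
qed

interpretation std_normal: prob_space std_normal_distribution
  by (rule prob_space_normal_density) simp

interpretation std_normal_pair: pair_prob_space std_normal_distribution std_normal_distribution ..

lemma sets_std_normal_pair:
  "sets (std_normal_distribution \<Otimes>\<^sub>M std_normal_distribution) = sets (borel :: (real \<times> real) measure)"
  by (simp add: borel_prod[symmetric] cong: sets_pair_measure_cong)

text \<open>
  Rotation invariance of the Gaussian measure together with its product structure: the coordinates of a
  Gaussian vector in any orthonormal frame are independent standard normal variables.
\<close>

lemma gauss2_orthonormal_frame:
  assumes "norm u = 1" "norm v = 1" "u \<bullet> v = 0"
  shows "gauss2 = distr (std_normal_distribution \<Otimes>\<^sub>M std_normal_distribution) borel (frame u v)"
proof -
  have sq: "(norm (frame u v (a, b)))\<^sup>2 = a\<^sup>2 + b\<^sup>2" for a b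
    using assms unfolding frame_def power2_norm_eq_inner norm_eq_1
    by (simp add: inner_add_left inner_add_right inner_commute[of v u] power2_eq_square)
  have dens: "ennreal (exp (- (norm (frame u v q))\<^sup>2 / 2) / (2 * pi))
      = (case q of (a, b) \<Rightarrow> ennreal (std_normal_density a) * ennreal (std_normal_density b))" for q
  proof (cases q)
    case (Pair a b)
    have "exp (- (a\<^sup>2 + b\<^sup>2) / 2) = exp (- a\<^sup>2 / 2) * exp (- b\<^sup>2 / 2)"
      unfolding exp_add[symmetric] by (simp add: add_divide_distrib)
    then have "exp (- (a\<^sup>2 + b\<^sup>2) / 2) / (2 * pi) = std_normal_density a * std_normal_density b"
      by (simp add: std_normal_density_def)
    then show ?thesis
      by (simp add: Pair sq ennreal_mult')
  qed
  have "gauss2 = density (distr lborel borel (frame u v)) (\<lambda>x. ennreal (exp (- (norm x)\<^sup>2 / 2) / (2 * pi)))"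
    by (simp add: gauss2_def lborel_orthonormal_frame[OF assms])
  also have "\<dots> = distr (density lborel (\<lambda>q. ennreal (exp (- (norm (frame u v q))\<^sup>2 / 2) / (2 * pi)))) borel (frame u v)"
    by (rule density_distr) auto
  also have "density lborel (\<lambda>q. ennreal (exp (- (norm (frame u v q))\<^sup>2 / 2) / (2 * pi)))
      = density lborel std_normal_density \<Otimes>\<^sub>M density lborel std_normal_density"
    unfolding dens lborel_prod[symmetric]
    by (rule pair_measure_density[symmetric])
      (auto intro: std_normal.sigma_finite_measure_axioms lborel.sigma_finite_measure_axioms)
  finally show ?thesis .
qed

lemma prob_space_gauss2: "prob_space gauss2"
proof -
  have eq: "gauss2 = distr (std_normal_distribution \<Otimes>\<^sub>M std_normal_distribution) borel (frame (axis 1 1) (axis 2 1))"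
    by (rule gauss2_orthonormal_frame) (auto simp: inner_axis_axis)
  have "frame (axis 1 1) (axis 2 1) \<in> measurable (std_normal_distribution \<Otimes>\<^sub>M std_normal_distribution) borel"
    by (simp add: measurable_cong_sets[OF sets_std_normal_pair refl])
  then show ?thesis
    unfolding eq by (rule std_normal_pair.P.prob_space_distr)
qed

lemma measure_gauss2_rectangle:
  assumes uv: "norm u = 1" "norm v = 1" "u \<bullet> v = 0"
    and A: "A \<in> sets borel" and B: "B \<in> sets borel"
  shows "measure gauss2 {z. z \<bullet> u \<in> A \<and> z \<bullet> v \<in> B}
    = measure std_normal_distribution A * measure std_normal_distribution B"
proof -
  have "{z \<in> space borel. z \<bullet> u \<in> A \<and> z \<bullet> v \<in> B} \<in> sets borel"
    using A B by measurable
  moreover have "frame u v -` {z. z \<bullet> u \<in> A \<and> z \<bullet> v \<in> B} = A \<times> B"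
    using uv by (auto simp: frame_def inner_add_left inner_commute[of v u] dot_square_norm)
  ultimately have "measure gauss2 {z. z \<bullet> u \<in> A \<and> z \<bullet> v \<in> B}
      = measure (std_normal_distribution \<Otimes>\<^sub>M std_normal_distribution) (A \<times> B)"
    unfolding gauss2_orthonormal_frame[OF uv]
    by (subst measure_distr) (auto simp: space_pair_measure measurable_cong_sets[OF sets_std_normal_pair refl])
  then show ?thesis
    using A B by (simp add: measure_def std_normal.emeasure_pair_measure_Times enn2real_mult)
qed

lemma AE_std_normal_neq: "AE y in std_normal_distribution. y \<noteq> x"
proof -
  have "AE y in lborel. 0 < ennreal (std_normal_density y) \<longrightarrow> y \<noteq> x"
    using AE_lborel_singleton[of x] by (rule eventually_mono) simp
  then show ?thesis by (simp add: AE_density)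
qed

lemma measure_std_normal_atLeast: "measure std_normal_distribution {x..} = 1 - Phi x"
proof -
  have "AE y in std_normal_distribution. y \<noteq> x"
    by (rule AE_std_normal_neq)
  then have "measure std_normal_distribution {x..} = measure std_normal_distribution (UNIV - {..x})"
    by (intro std_normal.finite_measure_eq_AE) (auto elim!: eventually_mono)
  also have "\<dots> = 1 - Phi x"
    using std_normal.prob_compl[of "{..x}"] by (simp add: Phi_def cdf_def)
  finally show ?thesis .
qed

text \<open>
  The integral is written in the distance \<open>s\<close> from the right end point, the variable in which the
  density is expanded afterwards.
\<close>

lemma measure_std_normal_interval:
  assumes "0 \<le> r"
  shows "measure std_normal_distribution {y - r..<y}
    = integral {0..r} (\<lambda>s. std_normal_density (y - s))"
proof -
  have cont: "continuous_on S (\<lambda>x. std_normal_density x)" for S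
    unfolding std_normal_density_def by (intro continuous_intros) auto
  have "AE t in std_normal_distribution. t \<noteq> y"
    by (rule AE_std_normal_neq)
  then have "measure std_normal_distribution {y - r..<y} = measure std_normal_distribution {y - r..y}"
    by (intro std_normal.finite_measure_eq_AE) (auto elim!: eventually_mono)
  also have "\<dots> = (LINT t:{y - r..y}|lborel. std_normal_density t)"
    unfolding measure_def
    by (subst emeasure_density) (auto simp: set_lebesgue_integral_def integral_eq_nn_integral indicator_def
        intro!: arg_cong[where f=enn2real] nn_integral_cong)
  also have "\<dots> = integral {y - r..y} std_normal_density"
    by (intro set_borel_integral_eq_integral borel_integrable_atLeastAtMost' cont)
  also have "\<dots> = integral {0..r} (\<lambda>s. std_normal_density (y - s))"
  proof -
    have "((\<lambda>s. std_normal_density (y - s)) has_integral integral {y - r..y} std_normal_density) {0..r}"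
    proof -
      have "(\<lambda>x. - x + y) ` {y - r..y} = {0..r}"
      proof (intro equalityI subsetI)
        fix t assume "t \<in> {0..r}"
        then show "t \<in> (\<lambda>x. - x + y) ` {y - r..y}"
          by (intro image_eqI[of _ _ "y - t"]) auto
      qed auto
      moreover have "(std_normal_density has_integral integral {y - r..y} std_normal_density) (cbox (y - r) y)"
        using integrable_continuous_real[OF cont] by (simp add: integrable_integral)
      ultimately show ?thesis
        using has_integral_affinity[of std_normal_density _ "y - r" y "- 1" y] by simp
    qed
    then show ?thesis by (simp add: integral_unique)
  qed
  finally show ?thesis .
qed

section \<open>Nearest points of a planar cone\<close>

text \<open>
  The variational inequality says that \<open>z - c\<close> makes no acute angle with any direction from \<open>c\<close>
  into the set, so by the law of cosines moving away from \<open>c\<close> inside the set cannot decrease the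
  distance to \<open>z\<close>.
\<close>

lemma infdist_eq_dist_nearest:
  fixes z :: "'a::real_inner"
  assumes "c \<in> C" and "\<And>x. x \<in> C \<Longrightarrow> (z - c) \<bullet> (x - c) \<le> 0"
  shows "infdist z C = dist z c"
proof (rule antisym)
  show "infdist z C \<le> dist z c"
    using assms(1) by (rule infdist_le)
  have "dist z c \<le> dist z x" if "x \<in> C" for x
  proof -
    have "(norm (z - c))\<^sup>2 \<le> (norm (z - x))\<^sup>2"
    proof -
      have "(norm (z - x))\<^sup>2 = (norm (z - c))\<^sup>2 + (norm (x - c))\<^sup>2 - 2 * ((z - c) \<bullet> (x - c))"
        by (simp add: power2_norm_eq_inner inner_diff_left inner_diff_right inner_commute)
      then show ?thesis using assms(2)[OF that] by (smt (verit) zero_le_power2)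
    qed
    then show ?thesis by (simp add: dist_norm)
  qed
  then show "dist z c \<le> infdist z C"
    using assms(1) by (subst infdist_notempty) (auto intro!: cINF_greatest)
qed

lemma orthonormal_expansion:
  fixes u v z :: "real^2"
  assumes "norm u = 1" "norm v = 1" "u \<bullet> v = 0"
  shows "z = (z \<bullet> u) *\<^sub>R u + (z \<bullet> v) *\<^sub>R v"
proof -
  have 1: "u $ 1 * u $ 1 + u $ 2 * u $ 2 = 1" "v $ 1 * v $ 1 + v $ 2 * v $ 2 = 1"
    "u $ 1 * v $ 1 + u $ 2 * v $ 2 = 0"
    using assms by (auto simp: norm_eq_1 inner_vec_def sum_2)
  have "z $ 1 = (z $ 1 * u $ 1 + z $ 2 * u $ 2) * u $ 1 + (z $ 1 * v $ 1 + z $ 2 * v $ 2) * v $ 1"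
    "z $ 2 = (z $ 1 * u $ 1 + z $ 2 * u $ 2) * u $ 2 + (z $ 1 * v $ 1 + z $ 2 * v $ 2) * v $ 2"
    using 1 by algebra+
  then show ?thesis by (simp add: vec_eq_iff forall_2 inner_vec_def sum_2)
qed

lemma orthonormal_inner:
  fixes u v y z :: "real^2"
  assumes "norm u = 1" "norm v = 1" "u \<bullet> v = 0"
  shows "y \<bullet> z = (y \<bullet> u) * (z \<bullet> u) + (y \<bullet> v) * (z \<bullet> v)"
  by (subst orthonormal_expansion[OF assms, of y])
    (simp add: inner_add_left inner_add_right inner_commute)

text \<open>
  The vectors \<open>p1\<close> and \<open>p2\<close> are the inward unit normals of the two edges. In the comments,
  \<open>\<theta>\<close> is the angle between \<open>v1\<close> and \<open>v2\<close>.
\<close>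

locale planar_cone =
  fixes v1 v2 p1 p2 w :: "real^2"
  assumes v1: "norm v1 = 1" and v2: "norm v2 = 1"
    and p1: "norm p1 = 1" "p1 \<bullet> v1 = 0" "p1 \<bullet> v2 > 0"
    and p2: "norm p2 = 1" "p2 \<bullet> v2 = 0" "p2 \<bullet> v1 > 0"
begin

text \<open>
  Exchanging the two edges is a symmetry, so facts proved for the first edge hold for the second.
\<close>

lemma swap: "planar_cone v2 v1 p2 p1"
  by unfold_locales (use v1 v2 p1 p2 in auto)

lemma inner_v1_p1: "y \<bullet> z = (y \<bullet> v1) * (z \<bullet> v1) + (y \<bullet> p1) * (z \<bullet> p1)"
  by (rule orthonormal_inner) (use v1 p1 in \<open>simp_all add: inner_commute\<close>)

lemma eqI_v1_p1:
  assumes "y \<bullet> v1 = z \<bullet> v1" "y \<bullet> p1 = z \<bullet> p1"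
  shows "y = z"
proof -
  have "(y - z) \<bullet> (y - z) = 0"
    unfolding inner_v1_p1[of "y - z" "y - z"] by (simp add: inner_diff_left assms)
  then show ?thesis by simp
qed

lemma cos_sin_sq: "(v1 \<bullet> v2)\<^sup>2 + (p1 \<bullet> v2)\<^sup>2 = 1"
  using inner_v1_p1[of v2 v2] v2 by (simp add: dot_square_norm inner_commute power2_eq_square)

text \<open>
  With \<open>v2 = (cos \<theta>, sin \<theta>)\<close> in the frame \<open>v1\<close>, \<open>p1\<close>, the only unit vectors orthogonal to \<open>v2\<close>
  are \<open>(sin \<theta>, - cos \<theta>)\<close> and its negative; positivity of \<open>p2 \<bullet> v1\<close> selects the first.
\<close>

lemma p2_coords: "p2 \<bullet> v1 = p1 \<bullet> v2" "p2 \<bullet> p1 = - (v1 \<bullet> v2)"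
proof -
  have 1: "(p2 \<bullet> v1)\<^sup>2 + (p2 \<bullet> p1)\<^sup>2 = 1"
    using inner_v1_p1[of p2 p2] p2 by (simp add: dot_square_norm power2_eq_square)
  have 2: "(p2 \<bullet> v1) * (v1 \<bullet> v2) + (p2 \<bullet> p1) * (p1 \<bullet> v2) = 0"
    using inner_v1_p1[of p2 v2] p2 by (simp add: inner_commute)
  have "(p2 \<bullet> v1)\<^sup>2 = (p1 \<bullet> v2)\<^sup>2"
    using 1 2 cos_sin_sq by algebra
  then show eq: "p2 \<bullet> v1 = p1 \<bullet> v2"
    using p1 p2 by (simp add: power2_eq_iff)
  have "(p1 \<bullet> v2) * (p2 \<bullet> p1 + v1 \<bullet> v2) = 0"
    using 2 unfolding eq by algebra
  then show "p2 \<bullet> p1 = - (v1 \<bullet> v2)" using p1 by auto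
qed

lemma inner_v2: "y \<bullet> v2 = (v1 \<bullet> v2) * (y \<bullet> v1) + (p1 \<bullet> v2) * (y \<bullet> p1)"
  using inner_v1_p1[of y v2] by (simp add: inner_commute mult.commute)

lemma inner_p2: "y \<bullet> p2 = (p1 \<bullet> v2) * (y \<bullet> v1) - (v1 \<bullet> v2) * (y \<bullet> p1)"
  using inner_v1_p1[of y p2] by (simp add: p2_coords mult.commute)

text \<open>
  The coefficients of \<open>z - w\<close> in the basis \<open>v1\<close>, \<open>v2\<close> are its inner products with \<open>p2\<close> and \<open>p1\<close>,
  divided by the positive number \<open>p1 \<bullet> v2 = p2 \<bullet> v1 = sin \<theta>\<close>.
\<close>

lemma mem_cone2_iff: "z \<in> cone2 v1 v2 w \<longleftrightarrow> (z - w) \<bullet> p1 \<ge> 0 \<and> (z - w) \<bullet> p2 \<ge> 0"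
proof
  assume "z \<in> cone2 v1 v2 w"
  then obtain a1 a2 where "0 \<le> a1" "0 \<le> a2" "z - w = a1 *\<^sub>R v1 + a2 *\<^sub>R v2"
    unfolding cone2_def by force
  then show "(z - w) \<bullet> p1 \<ge> 0 \<and> (z - w) \<bullet> p2 \<ge> 0"
    using p1 p2 by (simp add: inner_add_left inner_commute[of v1] inner_commute[of v2])
next
  assume *: "(z - w) \<bullet> p1 \<ge> 0 \<and> (z - w) \<bullet> p2 \<ge> 0"
  define a1 where "a1 = (z - w) \<bullet> p2 / (p1 \<bullet> v2)"
  define a2 where "a2 = (z - w) \<bullet> p1 / (p1 \<bullet> v2)"
  (* The defect is orthogonal to both normals, which are linearly independent, so it vanishes. *)
  define d where "d = z - w - a1 *\<^sub>R v1 - a2 *\<^sub>R v2"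
  have "d \<bullet> p1 = 0"
    using p1 by (simp add: d_def inner_diff_left a1_def a2_def inner_commute[of v1] inner_commute[of v2])
  moreover have "d \<bullet> p2 = 0"
    using p1 p2 p2_coords(1) by (simp add: d_def inner_diff_left a1_def a2_def inner_commute[of v1] inner_commute[of v2])
  ultimately have "d \<bullet> v1 = 0" "d \<bullet> p1 = 0"
    using inner_p2[of d] p1 by auto
  then have "d = 0"
    using inner_v1_p1[of d d] by simp
  then have "z = w + a1 *\<^sub>R v1 + a2 *\<^sub>R v2"
    by (simp add: d_def algebra_simps)
  moreover have "0 \<le> a1" "0 \<le> a2" using * p1 by (auto simp: a1_def a2_def)
  ultimately show "z \<in> cone2 v1 v2 w" unfolding cone2_def by blast
qed

text \<open>
  The orthogonal projection onto the first edge line lies on the edge itself, and \<open>z\<close> minus this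
  projection is an outward normal of the cone there.
\<close>

lemma infdist_edge:
  assumes "(z - w) \<bullet> p1 < 0" "(z - w) \<bullet> v1 \<ge> 0"
  shows "infdist z (cone2 v1 v2 w) = - ((z - w) \<bullet> p1)"
proof -
  define c where "c = w + ((z - w) \<bullet> v1) *\<^sub>R v1"
  have "z - w = ((z - w) \<bullet> v1) *\<^sub>R v1 + ((z - w) \<bullet> p1) *\<^sub>R p1"
    by (rule orthonormal_expansion) (use v1 p1 in \<open>simp_all add: inner_commute\<close>)
  then have zc: "z - c = ((z - w) \<bullet> p1) *\<^sub>R p1"
    unfolding c_def by (metis add_diff_cancel_left' diff_diff_eq)
  have "infdist z (cone2 v1 v2 w) = dist z c"
  proof (rule infdist_eq_dist_nearest)
    show "c \<in> cone2 v1 v2 w"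
      unfolding cone2_def c_def using assms by force
    fix x assume "x \<in> cone2 v1 v2 w"
    then have "(x - w) \<bullet> p1 \<ge> 0" using mem_cone2_iff by blast
    moreover have "(x - c) \<bullet> p1 = (x - w) \<bullet> p1"
      using p1 by (simp add: c_def inner_diff_left inner_add_left inner_commute[of v1])
    ultimately show "(z - c) \<bullet> (x - c) \<le> 0"
      using assms unfolding zc by (simp add: inner_commute mult_nonpos_nonneg)
  qed
  then show ?thesis using p1 assms by (simp add: dist_norm zc)
qed

text \<open>
  A vector that has negative inner product with both generators has nonpositive inner product with
  every element of the translated cone, so the apex is the nearest point.
\<close>

lemma infdist_vertex:
  assumes "(z - w) \<bullet> v1 < 0" "(z - w) \<bullet> v2 < 0"
  shows "infdist z (cone2 v1 v2 w) = norm (z - w)"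
proof -
  have "infdist z (cone2 v1 v2 w) = dist z w"
  proof (rule infdist_eq_dist_nearest)
    show "w \<in> cone2 v1 v2 w"
      unfolding cone2_def by force
    fix x assume "x \<in> cone2 v1 v2 w"
    then obtain a1 a2 where "0 \<le> a1" "0 \<le> a2" "x - w = a1 *\<^sub>R v1 + a2 *\<^sub>R v2"
      unfolding cone2_def by force
    then show "(z - w) \<bullet> (x - w) \<le> 0"
      using assms by (simp add: inner_add_right mult_nonneg_nonpos add_nonpos_nonpos)
  qed
  then show ?thesis by (simp add: dist_norm)
qed

lemma cone2_commute: "cone2 v2 v1 w = cone2 v1 v2 w"
  unfolding cone2_def by (metis (no_types, opaque_lifting) add.assoc add.commute)

end

section \<open>Strips along the edges\<close>

text \<open>
  The strict bound \<open>(z - w) \<bullet> p < 0\<close> keeps the edge itself in the cone, so that the parts of the tube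
  are disjoint and the strip of width \<open>0\<close> is empty.
\<close>

definition edge_strip :: "real^2 \<Rightarrow> real^2 \<Rightarrow> real^2 \<Rightarrow> real \<Rightarrow> (real^2) set" where
  "edge_strip v p w r = {z. (z - w) \<bullet> v \<ge> 0 \<and> - r \<le> (z - w) \<bullet> p \<and> (z - w) \<bullet> p < 0}"

lemma edge_strip_borel: "edge_strip v p w r \<in> sets borel"
proof -
  have "{z \<in> space borel. (z - w) \<bullet> v \<ge> 0 \<and> - r \<le> (z - w) \<bullet> p \<and> (z - w) \<bullet> p < 0} \<in> sets borel"
    by measurable
  then show ?thesis by (simp add: edge_strip_def)
qed

lemma measure_gauss2_edge_strip:
  assumes "norm v = 1" "norm p = 1" "v \<bullet> p = 0" "0 \<le> r"
  shows "measure gauss2 (edge_strip v p w r)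
    = (1 - Phi (v \<bullet> w)) * integral {0..r} (\<lambda>s. std_normal_density (p \<bullet> w - s))"
proof -
  have "edge_strip v p w r = {z. z \<bullet> v \<in> {v \<bullet> w..} \<and> z \<bullet> p \<in> {p \<bullet> w - r..<p \<bullet> w}}"
    by (auto simp: edge_strip_def inner_diff_left inner_commute[of w])
  then show ?thesis
    using assms by (simp only: measure_gauss2_rectangle atLeast_borel atLeastLessThan_borel
        measure_std_normal_atLeast measure_std_normal_interval)
qed

definition edge_coeff :: "real^2 \<Rightarrow> real^2 \<Rightarrow> real^2 \<Rightarrow> nat \<Rightarrow> real" where
  "edge_coeff v p w j = (if j = 0 then 0 else
     (1 - Phi (v \<bullet> w)) / sqrt (2 * pi) * hermite (j - 1) (p \<bullet> w) * exp (- (p \<bullet> w)\<^sup>2 / 2))"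

text \<open>
  Expand the density at distance \<open>s\<close> below \<open>p \<bullet> w\<close> by the generating function and integrate over
  \<open>s\<close>.
\<close>

lemma edge_strip_sums:
  assumes "norm v = 1" "norm p = 1" "v \<bullet> p = 0" "0 \<le> r"
  shows "(\<lambda>j. edge_coeff v p w j * (r ^ j / fact j)) sums measure gauss2 (edge_strip v p w r)"
proof -
  (* The standard normal density at the edge. *)
  define k where "k = exp (- (p \<bullet> w)\<^sup>2 / 2) / sqrt (2 * pi)"
  have "(\<lambda>n. (k * (hermite n (p \<bullet> w) / fact n)) * s ^ n) sums std_normal_density (p \<bullet> w - s)" for s
  proof -
    have "(\<lambda>n. k * (hermite n (p \<bullet> w) / fact n * s ^ n)) sums (k * exp (p \<bullet> w * s - s\<^sup>2 / 2))"
      by (intro sums_mult hermite_sums)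
    moreover have "exp (- (p \<bullet> w)\<^sup>2 / 2) * exp (p \<bullet> w * s - s\<^sup>2 / 2) = exp (- (p \<bullet> w - s)\<^sup>2 / 2)"
      unfolding exp_add[symmetric] by (simp add: power2_eq_square field_simps)
    then have "k * exp (p \<bullet> w * s - s\<^sup>2 / 2) = std_normal_density (p \<bullet> w - s)"
      by (simp add: k_def std_normal_density_def)
    ultimately show ?thesis by (simp only: mult.assoc)
  qed
  from sums_mult[OF powser_integral_sums[OF this \<open>0 \<le> r\<close>], of "1 - Phi (v \<bullet> w)"]
  have "(\<lambda>j. (1 - Phi (v \<bullet> w)) * ((if j = 0 then 0 else k * (hermite (j - 1) (p \<bullet> w) / fact (j - 1)) / real j) * r ^ j))
      sums measure gauss2 (edge_strip v p w r)"
    by (simp only: measure_gauss2_edge_strip[OF assms])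
  moreover have "(1 - Phi (v \<bullet> w)) * ((if j = 0 then 0 else k * (hermite (j - 1) (p \<bullet> w) / fact (j - 1)) / real j) * r ^ j)
      = edge_coeff v p w j * (r ^ j / fact j)" for j
    by (cases j) (simp_all add: edge_coeff_def k_def mult_ac)
  ultimately show ?thesis by simp
qed

section \<open>The sector at the apex, in polar coordinates\<close>

text \<open>
  The mixed open and closed bounds are those of the parameter domain of the sector; they differ from a
  closed box by a null set. The integral is moved to pairs, where the iterated integral is known for
  continuous integrands.
\<close>

lemma integral_cart2_iterated:
  fixes F :: "real \<times> real \<Rightarrow> real"
  assumes F: "continuous_on UNIV F"
  shows "integral {q :: real^2. 0 < q $ 1 \<and> q $ 1 \<le> r \<and> 0 < q $ 2 \<and> q $ 2 < T} (\<lambda>q. F (q $ 1, q $ 2))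
    = integral {0..r} (\<lambda>a. integral {0..T} (\<lambda>b. F (a, b)))"
proof -
  define S where "S = {q :: real^2. 0 < q $ 1 \<and> q $ 1 \<le> r \<and> 0 < q $ 2 \<and> q $ 2 < T}"
  define S' where "S' = {q :: real \<times> real. 0 < fst q \<and> fst q \<le> r \<and> 0 < snd q \<and> snd q < T}"
  have F': "continuous_on A (\<lambda>q :: real^2. F (q $ 1, q $ 2))" for A
    by (rule continuous_on_compose2[OF F]) (auto intro!: continuous_intros)
  have [measurable]: "F \<in> borel_measurable borel" "(\<lambda>q :: real^2. F (q $ 1, q $ 2)) \<in> borel_measurable borel"
    by (intro borel_measurable_continuous_onI F F')+
  have nth: "(\<lambda>q :: real^2. q $ i) \<in> borel_measurable borel" for i
    by (intro borel_measurable_continuous_onI continuous_intros)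
  have "{q \<in> space borel. 0 < q $ 1 \<and> q $ 1 \<le> r \<and> 0 < q $ 2 \<and> q $ 2 < T} \<in> sets (borel :: (real^2) measure)"
    using nth[of 1] nth[of 2] by measurable
  then have S [measurable]: "S \<in> sets borel" by (simp add: S_def)
  have "{q \<in> space borel. 0 < fst q \<and> fst q \<le> r \<and> 0 < snd q \<and> snd q < T} \<in> sets (borel :: (real \<times> real) measure)"
    unfolding borel_prod[symmetric] by measurable
  then have S' [measurable]: "S' \<in> sets borel" by (simp add: S'_def)
  have sub: "S \<subseteq> cbox 0 (vector [r, T])"
    by (auto simp: S_def mem_box_cart forall_2 vector_2)
  have sub': "S' \<subseteq> cbox (0, 0) (r, T)"
    by (auto simp: S'_def mem_box Basis_prod_def)
  have int: "set_integrable lborel S (\<lambda>q. F (q $ 1, q $ 2))"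
    by (rule set_integrable_subset[OF _ _ sub])
      (use borel_integrable_compact[OF compact_cbox F'] in \<open>auto simp: set_integrable_def\<close>)
  have int': "set_integrable lborel S' F"
    by (rule set_integrable_subset[OF _ _ sub'])
      (use borel_integrable_compact[OF compact_cbox continuous_on_subset[OF F]] in
        \<open>auto simp: set_integrable_def\<close>)
  have "integral S (\<lambda>q. F (q $ 1, q $ 2)) = (LINT q:S|distr lborel borel (frame (axis 1 1) (axis 2 1)). F (q $ 1, q $ 2))"
    using set_borel_integral_eq_integral(2)[OF int] by (simp add: lborel_standard_frame)
  also have "\<dots> = (LINT q:S'|lborel. F q)"
    unfolding set_lebesgue_integral_def
    by (subst integral_distr) (auto intro!: Bochner_Integration.integral_cong simp: frame_axis_nth S_def S'_def indicator_def)
  also have "\<dots> = integral S' F"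
    by (rule set_borel_integral_eq_integral(2)[OF int'])
  also have "\<dots> = integral (cbox (0, 0) (r, T)) F"
  proof (rule integral_spike_set)
    have "cbox (0, 0) (r, T) - S' \<subseteq> cbox (0, 0) (r, T) - box (0, 0) (r, T)"
      by (auto simp: S'_def mem_box Basis_prod_def)
    then show "negligible {x \<in> cbox (0, 0) (r, T) - S'. F x \<noteq> 0}"
      by (rule negligible_subset[OF negligible_frontier_interval, OF subset_trans, rotated]) auto
    show "negligible {x \<in> S' - cbox (0, 0) (r, T). F x \<noteq> 0}"
      using sub' by (auto intro: negligible_subset[OF negligible_empty])
  qed
  also have "\<dots> = integral {0..r} (\<lambda>a. integral {0..T} (\<lambda>b. F (a, b)))"
    by (subst integral_prod_continuous) (auto intro: continuous_on_subset[OF F])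
  finally show ?thesis unfolding S_def .
qed

text \<open>
  On a bounded set the continuous density is integrable, which links the measure to the gauge integral
  for which the change of variables theorem holds.
\<close>

lemma measure_gauss2_bounded:
  assumes A: "A \<in> sets borel" and "bounded A"
  shows "(\<lambda>z. exp (- (norm z)\<^sup>2 / 2) / (2 * pi)) absolutely_integrable_on A"
    and "measure gauss2 A = integral A (\<lambda>z. exp (- (norm z)\<^sup>2 / 2) / (2 * pi))"
proof -
  obtain a where a: "A \<subseteq> cbox (- a) a"
    using bounded_subset_cbox_symmetric[OF \<open>bounded A\<close>] .
  have cont: "continuous_on B (\<lambda>z :: real^2. exp (- (norm z)\<^sup>2 / 2) / (2 * pi))" for B
    by (intro continuous_intros) auto
  have int: "set_integrable lborel A (\<lambda>z. exp (- (norm z)\<^sup>2 / 2) / (2 * pi))"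
    by (rule set_integrable_subset[OF _ _ a])
      (use A borel_integrable_compact[OF compact_cbox cont] in \<open>auto simp: set_integrable_def\<close>)
  then show "(\<lambda>z. exp (- (norm z)\<^sup>2 / 2) / (2 * pi)) absolutely_integrable_on A"
    using A cont unfolding set_integrable_def
    by (subst integrable_completion) (auto intro!: borel_measurable_continuous_onI)
  have "measure gauss2 A = (LINT z:A|lborel. exp (- (norm z)\<^sup>2 / 2) / (2 * pi))"
  proof -
    define G where "G z = exp (- (norm z)\<^sup>2 / 2) / (2 * pi)" for z :: "real^2"
    have [measurable]: "G \<in> borel_measurable borel" "A \<in> sets borel"
      using cont A by (auto intro: borel_measurable_continuous_onI simp: G_def[abs_def])
    have "emeasure gauss2 A = (\<integral>\<^sup>+z. ennreal (indicator A z *\<^sub>R G z) \<partial>lborel)"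
      unfolding gauss2_def G_def[symmetric]
      by (subst emeasure_density) (auto intro!: nn_integral_cong split: split_indicator)
    moreover have "(LINT z:A|lborel. G z) = enn2real (\<integral>\<^sup>+z. ennreal (indicator A z *\<^sub>R G z) \<partial>lborel)"
      unfolding set_lebesgue_integral_def
      by (rule integral_eq_nn_integral) (auto simp: G_def)
    ultimately show ?thesis
      by (simp add: measure_def G_def)
  qed
  also have "\<dots> = integral A (\<lambda>z. exp (- (norm z)\<^sup>2 / 2) / (2 * pi))"
    by (rule set_borel_integral_eq_integral(2)[OF int])
  finally show "measure gauss2 A = integral A (\<lambda>z. exp (- (norm z)\<^sup>2 / 2) / (2 * pi))" .
qed

text \<open>
  The general theorem is about vector-valued integrands; a real function is read as a vector of
  length one.
\<close>

lemma integral_change_of_variables_scalar: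
  fixes f :: "real^'m::{finite,wellorder} \<Rightarrow> real" and g :: "real^'m::_ \<Rightarrow> real^'m::_"
  assumes "S \<in> sets lebesgue"
    and "\<And>x. x \<in> S \<Longrightarrow> (g has_derivative g' x) (at x within S)"
    and "inj_on g S"
    and f: "f absolutely_integrable_on (g ` S)"
  shows "integral (g ` S) f = integral S (\<lambda>x. \<bar>det (matrix (g' x))\<bar> * f (g x))"
proof -
  have "(\<lambda>x. vec (f x) :: real^1) absolutely_integrable_on (g ` S)"
    using f by (simp add: absolutely_integrable_on_1_iff)
  then have "integral (g ` S) (\<lambda>x. vec (f x) :: real^1)
      = integral S (\<lambda>x. \<bar>det (matrix (g' x))\<bar> *\<^sub>R (vec (f (g x)) :: real^1))"
    using integral_change_of_variables[OF assms(1-3)] by blast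
  then show ?thesis
    by (simp add: integral_on_1_eq vec_eq_iff)
qed

context planar_cone
begin

text \<open>
  The angle starts at the outward normal \<open>- p1\<close> of the first edge and turns towards \<open>- v1\<close>; the
  outward normal \<open>- p2\<close> of the second edge is reached at \<open>pi - \<theta>\<close>.
\<close>

definition polar :: "real^2 \<Rightarrow> real^2" where
  "polar q = w - q $ 1 *\<^sub>R (sin (q $ 2) *\<^sub>R v1 + cos (q $ 2) *\<^sub>R p1)"

definition polar' :: "real^2 \<Rightarrow> real^2 \<Rightarrow> real^2" where
  "polar' q h = - (h $ 1 *\<^sub>R (sin (q $ 2) *\<^sub>R v1 + cos (q $ 2) *\<^sub>R p1)
      + (q $ 1 * h $ 2) *\<^sub>R (cos (q $ 2) *\<^sub>R v1 - sin (q $ 2) *\<^sub>R p1))"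

lemma polar_coords:
  "(polar q - w) \<bullet> v1 = - (q $ 1 * sin (q $ 2))"
  "(polar q - w) \<bullet> p1 = - (q $ 1 * cos (q $ 2))"
  using v1 p1 by (simp_all add: polar_def inner_add_left inner_commute[of v1 p1] dot_square_norm)

lemma norm_polar: "norm (polar q - w) = \<bar>q $ 1\<bar>"
proof -
  have "(norm (polar q - w))\<^sup>2 = (q $ 1)\<^sup>2 * ((sin (q $ 2))\<^sup>2 + (cos (q $ 2))\<^sup>2)"
    unfolding power2_norm_eq_inner inner_v1_p1[of "polar q - w" "polar q - w"] polar_coords
    by algebra
  then have "(norm (polar q - w))\<^sup>2 = (q $ 1)\<^sup>2"
    by simp
  then show ?thesis
    by (metis abs_norm_cancel real_sqrt_abs)
qed

lemma has_derivative_polar: "(polar has_derivative polar' q) (at q within S)"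
proof -
  have nth: "((\<lambda>q :: real^2. q $ i) has_derivative (\<lambda>h. h $ i)) (at q within S)" for i
    by (rule bounded_linear_imp_has_derivative) (rule bounded_linear_vec_nth)
  show ?thesis
    unfolding polar_def[abs_def] polar'_def[abs_def]
    by (rule has_derivative_eq_rhs, (rule derivative_intros nth)+)
      (simp add: fun_eq_iff algebra_simps)
qed

text \<open>
  The frame \<open>v1\<close>, \<open>p1\<close> may have either orientation, so only the absolute value of the determinant is
  determined; it is found by squaring.
\<close>

lemma det_polar': "\<bar>det (matrix (polar' q))\<bar> = \<bar>q $ 1\<bar>"
proof -
  have 1: "v1 $ 1 * v1 $ 1 + v1 $ 2 * v1 $ 2 = 1" "p1 $ 1 * p1 $ 1 + p1 $ 2 * p1 $ 2 = 1"
    "p1 $ 1 * v1 $ 1 + p1 $ 2 * v1 $ 2 = 0"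
    using v1 p1 by (auto simp: norm_eq_1 inner_vec_def sum_2)
  have sc: "(sin (q $ 2))\<^sup>2 + (cos (q $ 2))\<^sup>2 = 1" by simp
  (* With sine and cosine abstracted, the determinant is a polynomial identity. *)
  define s c where "s = sin (q $ 2)" and "c = cos (q $ 2)"
  have entries: "matrix (polar' q) $ i $ 1 = - (s * v1 $ i + c * p1 $ i)"
      "matrix (polar' q) $ i $ 2 = - (q $ 1 * (c * v1 $ i - s * p1 $ i))" for i
    by (simp_all add: matrix_def polar'_def axis_def s_def c_def)
  have "det (matrix (polar' q)) = q $ 1 * (v1 $ 2 * p1 $ 1 - v1 $ 1 * p1 $ 2) * (s\<^sup>2 + c\<^sup>2)"
    unfolding det_2 entries by algebra
  then have "(det (matrix (polar' q)))\<^sup>2 = (q $ 1)\<^sup>2 * (v1 $ 2 * p1 $ 1 - v1 $ 1 * p1 $ 2)\<^sup>2"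
    using sc by (simp add: s_def c_def power_mult_distrib)
  also have "(v1 $ 2 * p1 $ 1 - v1 $ 1 * p1 $ 2)\<^sup>2 = 1"
    using 1 by algebra
  finally show ?thesis by (metis mult.right_neutral real_sqrt_abs)
qed

definition angle :: real where "angle = arccos (v1 \<bullet> v2)"

lemma cos_sin_angle: "cos angle = v1 \<bullet> v2" "sin angle = p1 \<bullet> v2" and angle_bounds: "0 < angle" "angle < pi"
proof -
  have lt: "\<bar>v1 \<bullet> v2\<bar> < 1"
  proof -
    have "(p1 \<bullet> v2)\<^sup>2 > 0" using p1 by simp
    then have "(v1 \<bullet> v2)\<^sup>2 < 1" using cos_sin_sq by linarith
    then show ?thesis by (simp add: abs_square_less_1)
  qed
  then show "cos angle = v1 \<bullet> v2" by (simp add: angle_def abs_less_iff)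
  show "sin angle = p1 \<bullet> v2"
  proof -
    have "1 - (v1 \<bullet> v2)\<^sup>2 = (p1 \<bullet> v2)\<^sup>2" using cos_sin_sq by linarith
    then show ?thesis
      unfolding angle_def using lt p1 by (simp add: sin_arccos abs_less_iff)
  qed
  show "0 < angle" "angle < pi"
    unfolding angle_def using lt arccos_lt_bounded[of "v1 \<bullet> v2"] by auto
qed

definition sector :: "real \<Rightarrow> (real^2) set" where
  "sector r = {z. (z - w) \<bullet> v1 < 0 \<and> (z - w) \<bullet> v2 < 0 \<and> norm (z - w) \<le> r}"

lemma inner_polar_v2: "(polar q - w) \<bullet> v2 = - (q $ 1 * sin (q $ 2 + angle))"
  unfolding inner_v2[of "polar q - w"] polar_coords sin_add cos_sin_angle by (simp add: algebra_simps)

lemma inj_on_polar: "inj_on polar {q. 0 < q $ 1 \<and> 0 < q $ 2 \<and> q $ 2 < pi}"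
proof (rule inj_onI)
  fix q q' assume q: "q \<in> {q. 0 < q $ 1 \<and> 0 < q $ 2 \<and> q $ 2 < pi}"
    and q': "q' \<in> {q. 0 < q $ 1 \<and> 0 < q $ 2 \<and> q $ 2 < pi}" and eq: "polar q = polar q'"
  have 1: "q $ 1 = q' $ 1"
    using norm_polar[of q] norm_polar[of q'] eq q q' by simp
  then have "cos (q $ 2) = cos (q' $ 2)"
    using polar_coords(2)[of q] polar_coords(2)[of q'] eq q by simp
  then have "q $ 2 = q' $ 2"
    using q q' by (intro cos_inj_pi[of "q $ 2" "q' $ 2"]) simp_all
  with 1 show "q = q'" unfolding vec_eq_iff forall_2 by blast
qed

text \<open>
  In polar coordinates the two defining inequalities of the sector are \<open>sin t > 0\<close> and
  \<open>sin (t + \<theta>) > 0\<close>, and for \<open>0 < t < pi\<close> the second one says \<open>t < pi - \<theta>\<close>.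
\<close>

lemma polar_image_sector:
  "polar ` {q. 0 < q $ 1 \<and> q $ 1 \<le> r \<and> 0 < q $ 2 \<and> q $ 2 < pi - angle} = sector r"
proof (intro equalityI subsetI)
  fix z assume "z \<in> polar ` {q. 0 < q $ 1 \<and> q $ 1 \<le> r \<and> 0 < q $ 2 \<and> q $ 2 < pi - angle}"
  then obtain q where q: "0 < q $ 1" "q $ 1 \<le> r" "0 < q $ 2" "q $ 2 < pi - angle" and z: "z = polar q"
    by auto
  have "0 < sin (q $ 2)" "0 < sin (q $ 2 + angle)"
    using q angle_bounds by (auto intro!: sin_gt_zero)
  then show "z \<in> sector r"
    using q unfolding sector_def z by (simp add: norm_polar polar_coords inner_polar_v2)
next
  fix z assume "z \<in> sector r"
  then have z: "(z - w) \<bullet> v1 < 0" "(z - w) \<bullet> v2 < 0" "norm (z - w) \<le> r"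
    by (auto simp: sector_def)
  define \<rho> where "\<rho> = norm (z - w)"
  (* This puts t strictly between 0 and pi, where the sine is positive. Since (z - w) \<bullet> v1 is
     negative, the squared relation between the two determines sin t. *)
  define t where "t = arccos (- ((z - w) \<bullet> p1) / \<rho>)"
  have "z \<noteq> w" using z by auto
  then have \<rho>: "\<rho> > 0" by (simp add: \<rho>_def)
  have sq: "\<rho>\<^sup>2 = ((z - w) \<bullet> v1)\<^sup>2 + ((z - w) \<bullet> p1)\<^sup>2"
    unfolding \<rho>_def power2_norm_eq_inner inner_v1_p1[of "z - w" "z - w"]
    by (simp only: power2_eq_square)
  have "((z - w) \<bullet> p1)\<^sup>2 < \<rho>\<^sup>2"
    using z unfolding sq by simp
  then have lt: "\<bar>- ((z - w) \<bullet> p1) / \<rho>\<bar> < 1"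
    using \<rho> power2_less_imp_less[of "\<bar>(z - w) \<bullet> p1\<bar>" \<rho>] by simp
  then have t: "0 < t" "t < pi" "cos t = - ((z - w) \<bullet> p1) / \<rho>"
    using arccos_lt_bounded[of "- ((z - w) \<bullet> p1) / \<rho>"] unfolding t_def abs_less_iff
    by (auto intro!: cos_arccos)
  have \<rho>_cos: "\<rho> * cos t = - ((z - w) \<bullet> p1)"
    using \<rho> t(3) by simp
  have "(\<rho> * sin t)\<^sup>2 + (\<rho> * cos t)\<^sup>2 = \<rho>\<^sup>2 * ((sin t)\<^sup>2 + (cos t)\<^sup>2)"
    by (simp only: power_mult_distrib distrib_left)
  then have "(\<rho> * sin t)\<^sup>2 = (- ((z - w) \<bullet> v1))\<^sup>2"
    unfolding \<rho>_cos sin_cos_squared_add using sq by simp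
  moreover have "\<rho> * sin t > 0" using \<rho> t by (simp add: sin_gt_zero)
  ultimately have sin_t: "\<rho> * sin t = - ((z - w) \<bullet> v1)"
    using z by (simp add: power2_eq_iff)
  define q :: "real^2" where "q = vector [\<rho>, t]"
  have q: "q $ 1 = \<rho>" "q $ 2 = t" by (simp_all add: q_def)
  have "polar q - w = z - w"
    by (rule eqI_v1_p1) (simp_all add: polar_coords q sin_t \<rho>_cos)
  then have zq: "z = polar q" by simp
  have "0 < sin (t + angle)"
    using z(2) \<rho> unfolding zq inner_polar_v2 q by (simp add: zero_less_mult_iff)
  then have "t < pi - angle"
    using t angle_bounds sin_le_zero[of "t + angle"] by (cases "t + angle < pi") auto
  then show "z \<in> polar ` {q. 0 < q $ 1 \<and> q $ 1 \<le> r \<and> 0 < q $ 2 \<and> q $ 2 < pi - angle}"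
    using zq q t \<rho> z(3) by (auto simp: \<rho>_def)
qed

lemma norm_polar_expand:
  "(norm (polar q))\<^sup>2 = (v1 \<bullet> w - q $ 1 * sin (q $ 2))\<^sup>2 + (p1 \<bullet> w - q $ 1 * cos (q $ 2))\<^sup>2"
proof -
  have "polar q \<bullet> v1 = v1 \<bullet> w - q $ 1 * sin (q $ 2)" "polar q \<bullet> p1 = p1 \<bullet> w - q $ 1 * cos (q $ 2)"
    using polar_coords[of q] inner_commute[of v1 w] inner_commute[of p1 w]
    by (simp_all add: inner_diff_left)
  then show ?thesis
    unfolding power2_norm_eq_inner inner_v1_p1[of "polar q" "polar q"] by (simp only: power2_eq_square)
qed

lemma sector_borel: "sector r \<in> sets borel"
proof -
  have "{z \<in> space borel. (z - w) \<bullet> v1 < 0 \<and> (z - w) \<bullet> v2 < 0 \<and> norm (z - w) \<le> r} \<in> sets borel"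
    by measurable
  then show ?thesis by (simp add: sector_def)
qed

lemma measure_gauss2_sector:
  "measure gauss2 (sector r) = integral {0..r} (\<lambda>\<rho>. integral {0..pi - angle} (\<lambda>t.
     \<rho> * (exp (- ((v1 \<bullet> w - \<rho> * sin t)\<^sup>2 + (p1 \<bullet> w - \<rho> * cos t)\<^sup>2) / 2) / (2 * pi))))"
proof -
  let ?G = "\<lambda>z :: real^2. exp (- (norm z)\<^sup>2 / 2) / (2 * pi)"
  let ?F = "\<lambda>(\<rho>, t). \<bar>\<rho>\<bar> * (exp (- ((v1 \<bullet> w - \<rho> * sin t)\<^sup>2 + (p1 \<bullet> w - \<rho> * cos t)\<^sup>2) / 2) / (2 * pi))"
  define S where "S = {q :: real^2. 0 < q $ 1 \<and> q $ 1 \<le> r \<and> 0 < q $ 2 \<and> q $ 2 < pi - angle}"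
  have nth: "(\<lambda>q :: real^2. q $ i) \<in> borel_measurable borel" for i
    by (intro borel_measurable_continuous_onI continuous_intros)
  have "{q \<in> space borel. 0 < q $ 1 \<and> q $ 1 \<le> r \<and> 0 < q $ 2 \<and> q $ 2 < pi - angle} \<in> sets (borel :: (real^2) measure)"
    using nth[of 1] nth[of 2] by measurable
  then have S: "S \<in> sets borel" by (simp add: S_def)
  have img: "polar ` S = sector r"
    unfolding S_def by (rule polar_image_sector)
  have "norm z \<le> norm w + r" if "z \<in> sector r" for z
    using that norm_triangle_sub[of z w] by (simp add: sector_def)
  then have "bounded (sector r)"
    unfolding bounded_iff by blast
  note G = measure_gauss2_bounded[OF sector_borel this]
  have "measure gauss2 (sector r) = integral (polar ` S) ?G"
    by (simp add: img G(2))
  also have "\<dots> = integral S (\<lambda>q. \<bar>det (matrix (polar' q))\<bar> * ?G (polar q))"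
  proof (rule integral_change_of_variables_scalar)
    show "inj_on polar S"
      by (rule inj_on_subset[OF inj_on_polar]) (use angle_bounds in \<open>auto simp: S_def\<close>)
  qed (use S G(1) img in \<open>auto intro: has_derivative_polar\<close>)
  also have "\<dots> = integral S (\<lambda>q. ?F (q $ 1, q $ 2))"
    by (simp add: det_polar' norm_polar_expand)
  also have "\<dots> = integral {0..r} (\<lambda>\<rho>. integral {0..pi - angle} (\<lambda>t. ?F (\<rho>, t)))"
    unfolding S_def
    by (rule integral_cart2_iterated) (auto simp: case_prod_beta intro!: continuous_intros)
  also have "\<dots> = integral {0..r} (\<lambda>\<rho>. integral {0..pi - angle} (\<lambda>t.
     \<rho> * (exp (- ((v1 \<bullet> w - \<rho> * sin t)\<^sup>2 + (p1 \<bullet> w - \<rho> * cos t)\<^sup>2) / 2) / (2 * pi))))"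
    by (intro integral_cong) simp
  finally show ?thesis .
qed

end

text \<open>
  For fixed radius the Cauchy product of the two generating functions is dominated, uniformly in the
  angle, by the Cauchy product of the absolute series at \<open>\<rho>\<close>, since sine and cosine are bounded by
  \<open>1\<close>. So it may be integrated termwise over \<open>t\<close>.
\<close>

lemma angular_sums:
  fixes x y T \<rho> :: real
  shows "(\<lambda>m. (\<Sum>l\<le>m. hermite l y / fact l * (hermite (m - l) x / fact (m - l))
              * integral {0..T} (\<lambda>t. sin t ^ (m - l) * cos t ^ l)) * \<rho> ^ m)
    sums integral {0..T} (\<lambda>t. exp (y * (\<rho> * cos t) - (\<rho> * cos t)\<^sup>2 / 2)
                            * exp (x * (\<rho> * sin t) - (\<rho> * sin t)\<^sup>2 / 2))"
proof -
  define f where "f m t = (\<Sum>l\<le>m. (hermite l y / fact l * (\<rho> * cos t) ^ l)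
      * (hermite (m - l) x / fact (m - l) * (\<rho> * sin t) ^ (m - l)))" for m t
  define M where "M m = (\<Sum>l\<le>m. norm (hermite l y / fact l * \<rho> ^ l)
      * norm (hermite (m - l) x / fact (m - l) * \<rho> ^ (m - l)))" for m
  have sum: "(\<lambda>m. f m t) sums (exp (y * (\<rho> * cos t) - (\<rho> * cos t)\<^sup>2 / 2)
                            * exp (x * (\<rho> * sin t) - (\<rho> * sin t)\<^sup>2 / 2))" for t
    using Cauchy_product_sums[OF hermite_summable_norm[of y "\<rho> * cos t"] hermite_summable_norm[of x "\<rho> * sin t"]]
    unfolding f_def by (simp only: sums_unique[OF hermite_sums, symmetric])
  have "(\<lambda>m. integral {0..T} (f m)) sums integral {0..T} (\<lambda>t. exp (y * (\<rho> * cos t) - (\<rho> * cos t)\<^sup>2 / 2)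
                            * exp (x * (\<rho> * sin t) - (\<rho> * sin t)\<^sup>2 / 2))"
  proof (rule sums_integral_Weierstrass)
    show "summable M"
      unfolding M_def using hermite_summable_norm by (intro summable_Cauchy_product) auto
    show "\<bar>f m t\<bar> \<le> M m" for m t
    proof -
      have trig: "\<bar>a * (\<rho> * u) ^ l\<bar> \<le> norm (a * \<rho> ^ l)" if "\<bar>u\<bar> \<le> 1" for a u and l :: nat
      proof -
        have "\<bar>u\<bar> ^ l \<le> 1" using that by (simp add: power_le_one)
        then have "\<bar>a\<bar> * \<bar>\<rho>\<bar> ^ l * \<bar>u\<bar> ^ l \<le> \<bar>a\<bar> * \<bar>\<rho>\<bar> ^ l * 1"
          by (intro mult_left_mono) auto
        then show ?thesis by (simp add: abs_mult power_mult_distrib power_abs mult_ac)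
      qed
      have "\<bar>f m t\<bar> \<le> (\<Sum>l\<le>m. \<bar>hermite l y / fact l * (\<rho> * cos t) ^ l\<bar>
          * \<bar>hermite (m - l) x / fact (m - l) * (\<rho> * sin t) ^ (m - l)\<bar>)"
        unfolding f_def abs_mult[symmetric] by (rule sum_abs)
      also have "\<dots> \<le> M m"
        unfolding M_def by (intro sum_mono mult_mono trig) auto
      finally show ?thesis .
    qed
    show "continuous_on {0..T} (f m)" for m
      unfolding f_def by (intro continuous_intros)
  qed (rule sum)
  moreover have "integral {0..T} (f m) = (\<Sum>l\<le>m. hermite l y / fact l * (hermite (m - l) x / fact (m - l))
              * integral {0..T} (\<lambda>t. sin t ^ (m - l) * cos t ^ l)) * \<rho> ^ m" for m
  proof -
    have "f m = (\<lambda>t. \<Sum>l\<le>m. (hermite l y / fact l * (hermite (m - l) x / fact (m - l)) * \<rho> ^ m)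
        * (sin t ^ (m - l) * cos t ^ l))"
      unfolding f_def
    proof (rule ext, rule sum.cong[OF refl])
      fix t l assume "l \<in> {..m}"
      then have "\<rho> ^ m = \<rho> ^ l * \<rho> ^ (m - l)" by (simp flip: power_add)
      then show "(hermite l y / fact l * (\<rho> * cos t) ^ l) * (hermite (m - l) x / fact (m - l) * (\<rho> * sin t) ^ (m - l))
        = (hermite l y / fact l * (hermite (m - l) x / fact (m - l)) * \<rho> ^ m) * (sin t ^ (m - l) * cos t ^ l)"
        by (simp add: power_mult_distrib)
    qed
    then have "integral {0..T} (f m) = (\<Sum>l\<le>m. integral {0..T} (\<lambda>t.
        (hermite l y / fact l * (hermite (m - l) x / fact (m - l)) * \<rho> ^ m) * (sin t ^ (m - l) * cos t ^ l)))"
      by (simp only:) (intro integral_sum integrable_continuous_real continuous_intros finite_atMost)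
    also have "\<dots> = (\<Sum>l\<le>m. (hermite l y / fact l * (hermite (m - l) x / fact (m - l)) * \<rho> ^ m)
        * integral {0..T} (\<lambda>t. sin t ^ (m - l) * cos t ^ l))"
      by (simp only: integral_mult_right)
    finally show ?thesis by (simp add: sum_distrib_left sum_distrib_right mult_ac)
  qed
  ultimately show ?thesis by simp
qed

context planar_cone
begin

definition sector_coeff :: "nat \<Rightarrow> real" where
  "sector_coeff j = (if j < 2 then 0 else
     1 / (2 * pi) * (\<Sum>l = 0..j - 2. real ((j - 2) choose l) * arc_coeff j l angle
        * hermite (j - 2 - l) (v1 \<bullet> w) * hermite l (p1 \<bullet> w) * exp (- (norm w)\<^sup>2 / 2)))"

text \<open>
  Expanding the squares in the exponent splits the density at a point of the sector into \<open>exp (- (norm w)\<^sup>2 / 2)\<close>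
  and two generating functions. The Jacobian \<open>\<rho>\<close> shifts the series by one power, and the integral
  over the radius by another, which is why the coefficients start at \<open>j = 2\<close>.
\<close>

lemma sector_sums:
  assumes r: "0 \<le> r"
  shows "(\<lambda>j. sector_coeff j * (r ^ j / fact j)) sums measure gauss2 (sector r)"
proof -
  define x y T where "x = v1 \<bullet> w" and "y = p1 \<bullet> w" and "T = pi - angle"
  define k where "k = exp (- (norm w)\<^sup>2 / 2) / (2 * pi)"
  define q where "q m = (\<Sum>l\<le>m. hermite l y / fact l * (hermite (m - l) x / fact (m - l))
              * integral {0..T} (\<lambda>t. sin t ^ (m - l) * cos t ^ l))" for m
  define J where "J \<rho> = integral {0..T} (\<lambda>t. exp (y * (\<rho> * cos t) - (\<rho> * cos t)\<^sup>2 / 2)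
                            * exp (x * (\<rho> * sin t) - (\<rho> * sin t)\<^sup>2 / 2))" for \<rho>
  have norm_w: "(norm w)\<^sup>2 = x\<^sup>2 + y\<^sup>2"
    unfolding power2_norm_eq_inner inner_v1_p1[of w w] x_def y_def
    by (simp only: power2_eq_square inner_commute[of w])
  have dens: "\<rho> * (exp (- ((x - \<rho> * sin t)\<^sup>2 + (y - \<rho> * cos t)\<^sup>2) / 2) / (2 * pi))
      = (k * \<rho>) * (exp (y * (\<rho> * cos t) - (\<rho> * cos t)\<^sup>2 / 2) * exp (x * (\<rho> * sin t) - (\<rho> * sin t)\<^sup>2 / 2))" for \<rho> t
  proof -
    have "exp (- ((x - \<rho> * sin t)\<^sup>2 + (y - \<rho> * cos t)\<^sup>2) / 2) = exp (- (norm w)\<^sup>2 / 2)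
        * (exp (y * (\<rho> * cos t) - (\<rho> * cos t)\<^sup>2 / 2) * exp (x * (\<rho> * sin t) - (\<rho> * sin t)\<^sup>2 / 2))"
      unfolding exp_add[symmetric] norm_w by (simp add: power2_diff field_simps)
    then show ?thesis by (simp add: k_def)
  qed
  have meas: "measure gauss2 (sector r) = integral {0..r} (\<lambda>\<rho>. k * \<rho> * J \<rho>)"
    unfolding measure_gauss2_sector x_def[symmetric] y_def[symmetric] T_def[symmetric] dens
      integral_mult_right J_def ..
  have pow: "(\<lambda>n. (if n = 0 then 0 else k * q (n - 1)) * \<rho> ^ n) sums (k * \<rho> * J \<rho>)" for \<rho>
  proof -
    have "(\<lambda>m. k * \<rho> * (q m * \<rho> ^ m)) sums (k * \<rho> * J \<rho>)"
      unfolding q_def J_def by (intro sums_mult angular_sums)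
    then have "(\<lambda>m. (if Suc m = 0 then 0 else k * q (Suc m - 1)) * \<rho> ^ Suc m) sums (k * \<rho> * J \<rho>)"
      by (simp add: mult_ac)
    then show ?thesis by (subst (asm) sums_Suc_iff) simp
  qed
  from powser_integral_sums[OF this r]
  have "(\<lambda>j. (if j = 0 then 0 else (if j - 1 = 0 then 0 else k * q (j - 1 - 1)) / real j) * r ^ j)
      sums measure gauss2 (sector r)"
    by (simp only: meas)
  moreover have "(if j = 0 then 0 else (if j - 1 = 0 then 0 else k * q (j - 1 - 1)) / real j) * r ^ j
      = sector_coeff j * (r ^ j / fact j)" for j
  proof (cases "j < 2")
    case True
    then show ?thesis by (cases j) (auto simp: sector_coeff_def)
  next
    case False
    then obtain m where j: "j = Suc (Suc m)" by (metis add_2_eq_Suc le_Suc_ex not_le)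
    have "sector_coeff j = k * (real (Suc m) * (\<Sum>l\<le>m. real (m choose l) * hermite l y * hermite (m - l) x
        * integral {0..T} (\<lambda>t. sin t ^ (m - l) * cos t ^ l)))"
      by (simp add: sector_coeff_def j arc_coeff_def k_def T_def x_def y_def sum_distrib_left
          atMost_atLeast0 mult_ac)
    also have "(\<Sum>l\<le>m. real (m choose l) * hermite l y * hermite (m - l) x
        * integral {0..T} (\<lambda>t. sin t ^ (m - l) * cos t ^ l)) = fact m * q m"
      unfolding q_def sum_distrib_left
      by (intro sum.cong refl) (simp add: binomial_fact)
    finally have coeff: "sector_coeff j = k * (real (Suc m) * (fact m * q m))" .
    (* The factor j - 1 of the arc coefficients is the one by which j! / j exceeds (j - 2)!. *)
    have fact_j: "fact j = real j * (real (Suc m) * fact m)"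
      by (simp add: j mult_ac)
    show ?thesis
      unfolding coeff fact_j using False by (simp add: j field_simps del: of_nat_Suc)
  qed
  ultimately show ?thesis by simp
qed

lemma cone2_borel: "cone2 v1 v2 w \<in> sets borel"
proof -
  have "{z \<in> space borel. (z - w) \<bullet> p1 \<ge> 0 \<and> (z - w) \<bullet> p2 \<ge> 0} \<in> sets borel"
    by measurable
  then show ?thesis by (simp add: mem_cone2_iff[symmetric])
qed

end

section \<open>Decomposition of the tube\<close>

text \<open>
  Here \<open>(a, b)\<close> are the coordinates of a vector in the frame \<open>v1\<close>, \<open>p1\<close>, with \<open>s = sin \<theta>\<close> and
  \<open>c = cos \<theta>\<close>, so that \<open>c * a + s * b\<close> and \<open>s * a - c * b\<close> are its inner products with \<open>v2\<close> and
  \<open>p2\<close>. The first two implications keep the parts of the tube disjoint; the last two show that they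
  cover it.
\<close>

lemma quadrant_signs:
  fixes a b c s :: real
  assumes s: "s > 0"
  shows "a < 0 \<Longrightarrow> b \<ge> 0 \<Longrightarrow> s * a - c * b \<ge> 0 \<Longrightarrow> c * a + s * b \<ge> 0"
    and "a \<ge> 0 \<Longrightarrow> b < 0 \<Longrightarrow> s * a - c * b < 0 \<Longrightarrow> c * a + s * b < 0"
    and "a \<ge> 0 \<Longrightarrow> b \<ge> 0 \<Longrightarrow> s * a - c * b < 0 \<Longrightarrow> c * a + s * b \<ge> 0"
    and "b < 0 \<Longrightarrow> s * a - c * b \<ge> 0 \<Longrightarrow> c * a + s * b \<ge> 0 \<Longrightarrow> a \<ge> 0"
proof -
  show "c * a + s * b \<ge> 0" if "a < 0" "b \<ge> 0" "s * a - c * b \<ge> 0"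
  proof -
    have "s * a < 0" using s that by (simp add: mult_pos_neg)
    then have "c * b < 0" using that by linarith
    then have "c < 0" using that by (auto simp: mult_less_0_iff)
    then show ?thesis using s that by (simp add: mult_nonpos_nonpos)
  qed
  show "c * a + s * b < 0" if "a \<ge> 0" "b < 0" "s * a - c * b < 0"
  proof -
    have "s * a \<ge> 0" using s that by simp
    then have "c * b > 0" using that by linarith
    then have "c < 0" using that by (auto simp: zero_less_mult_iff)
    then have "c * a \<le> 0" using that by (simp add: mult_nonpos_nonneg)
    moreover have "s * b < 0" using s that by (simp add: mult_pos_neg)
    ultimately show ?thesis by linarith
  qed
  show "c * a + s * b \<ge> 0" if "a \<ge> 0" "b \<ge> 0" "s * a - c * b < 0"
  proof -
    have "s * a \<ge> 0" using s that by simp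
    then have "c * b > 0" using that by linarith
    then have "c > 0" using that by (auto simp: zero_less_mult_iff)
    then show ?thesis using s that by simp
  qed
  show "a \<ge> 0" if "b < 0" "s * a - c * b \<ge> 0" "c * a + s * b \<ge> 0"
  proof (rule ccontr)
    assume a: "\<not> a \<ge> 0"
    then have "s * a < 0" using s by (simp add: mult_pos_neg)
    then have "c * b < 0" using that by linarith
    then have "c > 0" using that by (auto simp: mult_less_0_iff)
    then have "c * a < 0" using a by (simp add: mult_pos_neg)
    moreover have "s * b < 0" using s that by (simp add: mult_pos_neg)
    ultimately show False using that by linarith
  qed
qed

context planar_cone
begin

text \<open>
  The four cases are the four possible positions of the nearest point: \<open>z\<close> itself, a point of one of
  the edges, or the apex. In each of them the distance to the cone is known, and the bound \<open>r\<close> on it is the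
  remaining condition in the definition of the corresponding part.
\<close>

lemma tube_eq_Un:
  assumes r: "0 \<le> r"
  shows "tube (cone2 v1 v2 w) r
    = cone2 v1 v2 w \<union> edge_strip v1 p1 w r \<union> edge_strip v2 p2 w r \<union> sector r"
proof (rule set_eqI)
  fix z
  let ?a = "(z - w) \<bullet> v1" and ?b = "(z - w) \<bullet> p1"
  let ?a' = "(z - w) \<bullet> v2" and ?b' = "(z - w) \<bullet> p2"
  note signs = quadrant_signs[OF p1(3), where a = ?a and b = ?b and c = "v1 \<bullet> v2",
      folded inner_v2[of "z - w"] inner_p2[of "z - w"]]
  have swapped: "infdist z (cone2 v1 v2 w) = - ?b'" if "?b' < 0" "?a' \<ge> 0"
    using planar_cone.infdist_edge[OF swap, where z = z and w = w] that by (simp add: cone2_commute)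
  consider "?b \<ge> 0" "?b' \<ge> 0" | "?b < 0" "?a \<ge> 0" | "?b' < 0" "?a' \<ge> 0" | "?a < 0" "?a' < 0"
    using signs(3,4) by linarith
  then show "z \<in> tube (cone2 v1 v2 w) r \<longleftrightarrow>
      z \<in> cone2 v1 v2 w \<union> edge_strip v1 p1 w r \<union> edge_strip v2 p2 w r \<union> sector r"
  proof cases
    case 1
    then have "z \<in> cone2 v1 v2 w" using mem_cone2_iff by blast
    then show ?thesis using r by (simp add: tube_def)
  next
    case 2
    then show ?thesis
      using signs(2) infdist_edge[of z]
      by (auto simp: tube_def edge_strip_def sector_def mem_cone2_iff)
  next
    case 3
    then show ?thesis
      using signs(2) swapped
      by (auto simp: tube_def edge_strip_def sector_def mem_cone2_iff)
  next
    case 4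
    then show ?thesis
      using signs(1) infdist_vertex[of z]
      by (auto simp: tube_def edge_strip_def sector_def mem_cone2_iff)
  qed
qed

lemma tube_parts_disjoint:
  "cone2 v1 v2 w \<inter> edge_strip v1 p1 w r = {}"
  "(cone2 v1 v2 w \<union> edge_strip v1 p1 w r) \<inter> edge_strip v2 p2 w r = {}"
  "(cone2 v1 v2 w \<union> edge_strip v1 p1 w r \<union> edge_strip v2 p2 w r) \<inter> sector r = {}"
proof -
  note signs = quadrant_signs(1,2)[OF p1(3), where a = "(z - w) \<bullet> v1" and b = "(z - w) \<bullet> p1" and c = "v1 \<bullet> v2" for z,
      folded inner_v2[of "z - w" for z] inner_p2[of "z - w" for z]]
  show "cone2 v1 v2 w \<inter> edge_strip v1 p1 w r = {}"
    by (auto simp: edge_strip_def mem_cone2_iff)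
  show "(cone2 v1 v2 w \<union> edge_strip v1 p1 w r) \<inter> edge_strip v2 p2 w r = {}"
    using signs(2) by (fastforce simp: edge_strip_def mem_cone2_iff)
  show "(cone2 v1 v2 w \<union> edge_strip v1 p1 w r \<union> edge_strip v2 p2 w r) \<inter> sector r = {}"
    using signs(1) by (fastforce simp: edge_strip_def sector_def mem_cone2_iff)
qed

lemma measure_gauss2_tube:
  assumes r: "0 \<le> r"
  shows "measure gauss2 (tube (cone2 v1 v2 w) r)
    = measure gauss2 (cone2 v1 v2 w) + measure gauss2 (edge_strip v1 p1 w r)
      + measure gauss2 (edge_strip v2 p2 w r) + measure gauss2 (sector r)"
proof -
  interpret prob_space gauss2 by (rule prob_space_gauss2)
  have [simp]: "sets gauss2 = sets borel" by (simp add: gauss2_def)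
  show ?thesis
    unfolding tube_eq_Un[OF r]
    by (simp add: finite_measure_Union tube_parts_disjoint cone2_borel edge_strip_borel sector_borel sets.Un)
qed

definition tube_coeff :: "nat \<Rightarrow> real" where
  "tube_coeff j = (if j = 0 then measure gauss2 (cone2 v1 v2 w) else 0)
     + edge_coeff v1 p1 w j + edge_coeff v2 p2 w j + sector_coeff j"

lemma tube_sums:
  assumes r: "0 \<le> r"
  shows "(\<lambda>j. tube_coeff j * (r ^ j / fact j)) sums measure gauss2 (tube (cone2 v1 v2 w) r)"
proof -
  have "(\<lambda>j. if j = 0 then measure gauss2 (cone2 v1 v2 w) * (r ^ j / fact j) else 0)
      sums measure gauss2 (cone2 v1 v2 w)"
    using sums_single[of 0 "\<lambda>j. measure gauss2 (cone2 v1 v2 w) * (r ^ j / fact j)"] by simp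
  then have "(\<lambda>j. (if j = 0 then measure gauss2 (cone2 v1 v2 w) else 0) * (r ^ j / fact j))
      sums measure gauss2 (cone2 v1 v2 w)"
    by (rule sums_cong[THEN iffD1, rotated]) simp
  moreover have "(\<lambda>j. edge_coeff v1 p1 w j * (r ^ j / fact j)) sums measure gauss2 (edge_strip v1 p1 w r)"
    by (rule edge_strip_sums) (use v1 p1 r in \<open>simp_all add: inner_commute\<close>)
  moreover have "(\<lambda>j. edge_coeff v2 p2 w j * (r ^ j / fact j)) sums measure gauss2 (edge_strip v2 p2 w r)"
    by (rule edge_strip_sums) (use v2 p2 r in \<open>simp_all add: inner_commute\<close>)
  ultimately have "(\<lambda>j. (if j = 0 then measure gauss2 (cone2 v1 v2 w) else 0) * (r ^ j / fact j)
        + edge_coeff v1 p1 w j * (r ^ j / fact j) + edge_coeff v2 p2 w j * (r ^ j / fact j)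
        + sector_coeff j * (r ^ j / fact j)) sums measure gauss2 (tube (cone2 v1 v2 w) r)"
    unfolding measure_gauss2_tube[OF r] by (intro sums_add sector_sums[OF r])
  then show ?thesis
    by (simp only: tube_coeff_def distrib_right)
qed

lemma gauss_minkowski_cone2: "gauss_minkowski j (cone2 v1 v2 w) = tube_coeff j"
proof (rule gauss_minkowski_eqI)
  show "has_tube_expansion (cone2 v1 v2 w) tube_coeff"
    unfolding has_tube_expansion_def using tube_sums by (intro exI[of _ 1]) auto
qed

end

theorem lemma5p4:
  fixes v1 v2 w p1 p2 :: "real^2" and \<theta> :: real
  assumes "norm v1 = 1" and "norm v2 = 1"
    and "v1 \<noteq> v2" and "independent {v1, v2}"
    and "\<theta> = arccos (v1 \<bullet> v2)"
    and "norm p1 = 1" and "p1 \<bullet> v1 = 0" and "p1 \<bullet> v2 > 0"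
    and "norm p2 = 1" and "p2 \<bullet> v2 = 0" and "p2 \<bullet> v1 > 0"
  shows "(\<forall>r\<ge>0. (\<lambda>j. gauss_minkowski j (cone2 v1 v2 w) * (r ^ j / fact j))
            sums measure gauss2 (tube (cone2 v1 v2 w) r))
    \<and> gauss_minkowski 0 (cone2 v1 v2 w) = measure gauss2 (cone2 v1 v2 w)
    \<and> gauss_minkowski 1 (cone2 v1 v2 w) =
          (1 - Phi (v1 \<bullet> w)) / sqrt (2 * pi) * exp (- (p1 \<bullet> w)\<^sup>2 / 2)
        + (1 - Phi (v2 \<bullet> w)) / sqrt (2 * pi) * exp (- (p2 \<bullet> w)\<^sup>2 / 2)
    \<and> (\<forall>j\<ge>2. gauss_minkowski j (cone2 v1 v2 w) =
          (1 - Phi (v1 \<bullet> w)) / sqrt (2 * pi) * hermite (j - 1) (p1 \<bullet> w) * exp (- (p1 \<bullet> w)\<^sup>2 / 2)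
        + (1 - Phi (v2 \<bullet> w)) / sqrt (2 * pi) * hermite (j - 1) (p2 \<bullet> w) * exp (- (p2 \<bullet> w)\<^sup>2 / 2)
        + 1 / (2 * pi) * (\<Sum>l = 0..j - 2. real ((j - 2) choose l) * arc_coeff j l \<theta>
              * hermite (j - 2 - l) (v1 \<bullet> w) * hermite l (p1 \<bullet> w) * exp (- (norm w)\<^sup>2 / 2)))"
proof -
  interpret cone: planar_cone v1 v2 p1 p2 w
    by unfold_locales (use assms in auto)
  have angle: "cone.angle = \<theta>"
    by (simp add: cone.angle_def assms)
  have "hermite 0 x = 1" for x
    by (simp add: hermite_def flip: exp_add)
  then show ?thesis
    using cone.tube_sums
    by (simp add: cone.gauss_minkowski_cone2 cone.tube_coeff_def edge_coeff_def cone.sector_coeff_def angle)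
qed

end
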